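(* Let $k$ be a positive integer with $k\le d-1$ and $\alpha\in(0,d)$ with $\frac{d-k}{2}<\alpha<d-\frac{k}{2}$. Write $\mathbb{R}^d=\mathbb{R}^{k+1}\times\mathbb{R}^{d-(k+1)}$, let $S^k\subset\mathbb{R}^{k+1}\times\{0\}$ be the $k$-dimensional unit sphere, and let $\mu_k=\mathcal{H}^k\llcorner S^k$. Then $\mu_k\in M_b(\mathbb{R}^d)\cap\dot{B}^{k-d}_{\infty,\infty}(\mathbb{R}^d)$ and $$\|\widehat{I_\alpha\mu_k}\|_{L^{\frac{2d}{2\alpha+k},q}}=+\infty\quad\text{for all }0<q<\infty.$$
   Context: $\mathcal{H}^k\llcorner S^k$ is $k$-dimensional Hausdorff measure restricted to $S^k$. $p_t(x)=(4\pi t)^{-d/2}e^{-|x|^2/(4t)}$, $\|f\|_{\dot{B}^{k-d}_{\infty,\infty}}:=\sup_{t>0}t^{\frac{d-k}{2}}\|p_t*f\|_{L^\infty}$ and $\dot{B}^{k-d}_{\infty,\infty}$ is the set of tempered distributions for which it is finite; $M_b$ is the space of finite Radon measures. The Fourier transform is $\widehat{\mu}(\xi)=\int e^{-2\pi i x\cdot\xi}\,d\mu(x)$ and $I_\alpha$ is the Riesz potential of order $\alpha$, so $\widehat{I_\alpha\mu}(\xi)=(2\pi|\xi|)^{-\alpha}\widehat{\mu}(\xi)$. For $0<q<\infty$, $\|g\|_{L^{p,q}}^q=\int_0^\infty\big(t\,|\{\xi:|g(\xi)|>t\}|^{1/p}\big)^q\frac{dt}{t}$. *)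

theory Defs
  imports "HOL-Analysis.Analysis"
begin

text \<open>Coordinates of R^d = real^'n are indexed by a finite well-ordered type;
  the i-th coordinate (0-based) is the index with exactly i smaller indices.
  "First k+1 coordinates" = indices of rank < k+1.\<close>
definition coord_rank :: "'n::{finite,wellorder} \<Rightarrow> nat" where
  "coord_rank i = card {j. j < i}"

definition sphere_k :: "nat \<Rightarrow> (real^'n::{finite,wellorder}) set" where
  "sphere_k k = {x. (\<forall>i. k + 1 \<le> coord_rank i \<longrightarrow> x $ i = 0) \<and> norm x = 1}"

text \<open>Normalising constant: volume of the unit ball in R^s.\<close>
definition omega_s :: "real \<Rightarrow> real" where
  "omega_s s = pi powr (s / 2) / Gamma (s / 2 + 1)"

definition hausdorff_pre :: "real \<Rightarrow> real \<Rightarrow> 'a::metric_space set \<Rightarrow> ennreal" where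
  "hausdorff_pre s \<delta> A = (INF C \<in> {C :: nat \<Rightarrow> 'a set. A \<subseteq> (\<Union>i. C i) \<and>
        (\<forall>i. bounded (C i) \<and> diameter (C i) \<le> \<delta>)}.
      (\<Sum>i. ennreal (omega_s s * (diameter (C i) / 2) powr s)))"

definition hausdorff_measure :: "real \<Rightarrow> 'a::metric_space set \<Rightarrow> ennreal" where
  "hausdorff_measure s A = (SUP \<delta> \<in> {0<..}. hausdorff_pre s \<delta> A)"

definition mu_k :: "nat \<Rightarrow> (real^'n::{finite,wellorder}) measure" where
  "mu_k k = measure_of UNIV (sets borel)
      (\<lambda>A. hausdorff_measure (real k) (A \<inter> sphere_k k))"

definition fourier_measure :: "('a::euclidean_space) measure \<Rightarrow> 'a \<Rightarrow> complex" where
  "fourier_measure \<mu> \<xi> = integral\<^sup>L \<mu> (\<lambda>x. cis (- 2 * pi * (x \<bullet> \<xi>)))"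

definition fourier_riesz :: "real \<Rightarrow> ('a::euclidean_space) measure \<Rightarrow> 'a \<Rightarrow> complex" where
  "fourier_riesz \<alpha> \<mu> \<xi> = complex_of_real ((2 * pi * norm \<xi>) powr (- \<alpha>)) * fourier_measure \<mu> \<xi>"

definition epowr :: "ennreal \<Rightarrow> real \<Rightarrow> ennreal" where
  "epowr x a = (if x = \<infinity> then \<infinity> else ennreal (enn2real x powr a))"

text \<open>||g||_{L^{p,q}}^q = int_0^infty (t |{|g|>t}|^{1/p})^q dt/t
   = int_0^infty t^(q-1) |{|g|>t}|^(q/p) dt.\<close>
definition lorentz_q :: "real \<Rightarrow> real \<Rightarrow> ('a::euclidean_space \<Rightarrow> complex) \<Rightarrow> ennreal" where
  "lorentz_q p q g = (\<integral>\<^sup>+ t. indicator {0<..} t *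
      (ennreal (t powr (q - 1)) * epowr (emeasure lborel {\<xi>. norm (g \<xi>) > t}) (q / p)) \<partial>lborel)"

definition heat_kernel :: "real \<Rightarrow> 'a::euclidean_space \<Rightarrow> real" where
  "heat_kernel t x = (4 * pi * t) powr (- real DIM('a) / 2) * exp (- (norm x)\<^sup>2 / (4 * t))"

text \<open>Finiteness of the homogeneous Besov norm of order s-d (B^{s-d}_{inf,inf}):
  sup_{t>0} t^{(d-s)/2} ||p_t * mu||_{L^infty} < infinity.\<close>
definition besov_finite :: "real \<Rightarrow> ('a::euclidean_space) measure \<Rightarrow> bool" where
  "besov_finite s \<mu> = (\<exists>C. \<forall>t>0. AE x in lborel.
      t powr ((real DIM('a) - s) / 2) * \<bar>\<integral> y. heat_kernel t (x - y) \<partial>\<mu>\<bar> \<le> C)"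

end

theory Submission
  imports Defs "HOL-Real_Asymp.Real_Asymp"
begin

text \<open>Since the sphere is locally a Lipschitz graph, \<open>\<mu>\<^sub>k(B(x,r)) \<le> C r\<^sup>k\<close>, which gives finiteness and,
  splitting space into annuli around \<open>x\<close>, the Besov bound. For the Fourier transform no Bessel
  asymptotics are used: invariance under reflections makes \<open>\<mu>\<^sub>k\<close>'s cosine transform a radial function
  \<open>\<phi>\<close> of the projection to the first \<open>k + 1\<close> coordinates, and rotation invariance yields
  \<open>r (\<phi>'' + 4 \<pi>\<^sup>2 \<phi>) + k \<phi>' = 0\<close>. The energy of \<open>r\<^bsup>k/2\<^esup> \<phi>\<close> therefore stays between two positive
  constants, so \<open>|\<phi>(r)| \<ge> c r\<^bsup>-k/2\<^esup>\<close> on a fixed proportion of every unit interval. Hence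
  \<open>|\<xi>|\<^bsup>-\<alpha>\<^esup> |\<phi>| > t\<close> on a set of measure at least a multiple of \<open>t\<^bsup>-p\<^esup>\<close>, \<open>p = 2d/(2\<alpha>+k)\<close>, for all small \<open>t\<close>,
  and the Lorentz integral dominates \<open>\<integral> dt/t\<close> near \<open>0\<close>.\<close>

section \<open>Hausdorff measure is a Borel measure\<close>

text \<open>\<open>mu_k\<close> is built with \<open>measure_of\<close>, which yields the zero
  measure unless its set function is countably additive; hence the Caratheodory argument for
  Hausdorff measure. Strict positivity of the sphere's mass matters as much: it makes \<phi>(0)
  nonzero and so excludes the zero solution of the equation. As the equation is singular at 0, the
  energy estimate starts at a small r0 > 0 with \<phi>(r0) still nonzero. Since \<phi> oscillates
  through zero, no pointwise lower bound can hold, and sets of definite measure take its place. They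
  are counted in all d coordinates although \<phi> sees only a projection: the projection is no
  longer than \<xi>, so replacing its length by |\<xi>| in a negative power only weakens the bound.
  Put a = \<alpha> + k/2. Size N^-a on a volume N^d means level sets of volume t^(-d/a), and p = d/a
  is the exponent for which the q/p-th power times t^(q-1) is 1/t, whatever q is. Reflections stand
  in for rotations: one explicit involution carries a vector to any other of the same norm.\<close>

lemma hausdorff_pre_le:
  assumes "A \<subseteq> (\<Union>i. C i)" "\<And>i. bounded (C i)" "\<And>i. diameter (C i) \<le> \<delta>"
  shows "hausdorff_pre s \<delta> A \<le> (\<Sum>i. ennreal (omega_s s * (diameter (C i) / 2) powr s))"
  unfolding hausdorff_pre_def using assms by (intro INF_lower) auto

lemma hausdorff_pre_lessE:
  assumes "hausdorff_pre s \<delta> A < e"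
  obtains C :: "nat \<Rightarrow> _" where "A \<subseteq> (\<Union>i. C i)" "\<And>i. bounded (C i)" "\<And>i. diameter (C i) \<le> \<delta>"
    "(\<Sum>i. ennreal (omega_s s * (diameter (C i) / 2) powr s)) < e"
  using assms unfolding hausdorff_pre_def INF_less_iff by auto

lemma hausdorff_pre_mono: "A \<subseteq> B \<Longrightarrow> hausdorff_pre s \<delta> A \<le> hausdorff_pre s \<delta> B"
  unfolding hausdorff_pre_def by (rule INF_superset_mono) auto

lemma hausdorff_pre_antimono: "\<delta> \<le> \<epsilon> \<Longrightarrow> hausdorff_pre s \<epsilon> A \<le> hausdorff_pre s \<delta> A"
  unfolding hausdorff_pre_def by (rule INF_superset_mono) (auto intro: order_trans)

lemma hausdorff_pre_empty: "0 \<le> \<delta> \<Longrightarrow> hausdorff_pre s \<delta> {} = 0"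
  using hausdorff_pre_le[of "{}" "\<lambda>_. {}" \<delta> s] by simp

lemma hausdorff_pre_countably_subadditive:
  fixes A :: "nat \<Rightarrow> 'a::metric_space set"
  shows "hausdorff_pre s \<delta> (\<Union>n. A n) \<le> (\<Sum>n. hausdorff_pre s \<delta> (A n))"
proof (cases "(\<Sum>n. hausdorff_pre s \<delta> (A n)) = \<infinity>")
  case False
  let ?w = "\<lambda>C :: 'a set. ennreal (omega_s s * (diameter C / 2) powr s)"
  have fin: "hausdorff_pre s \<delta> (A n) \<noteq> \<infinity>" for n
    using False ennreal_suminf_lessD by (metis infinity_ennreal_def top.not_eq_extremum)
  show ?thesis
  proof (rule ennreal_le_epsilon)
    fix e :: real assume e: "0 < e"
    have "\<exists>C. A n \<subseteq> (\<Union>i. C i) \<and> (\<forall>i. bounded (C i)) \<and> (\<forall>i. diameter (C i) \<le> \<delta>) \<and>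
        (\<Sum>i::nat. ?w (C i)) \<le> hausdorff_pre s \<delta> (A n) + ennreal (e * (1/2) ^ Suc n)" for n
    proof -
      have "hausdorff_pre s \<delta> (A n) < hausdorff_pre s \<delta> (A n) + ennreal (e * (1/2) ^ Suc n)"
        using fin[of n] e by (simp add: ennreal_add_left_cancel_less top.not_eq_extremum ennreal_zero_less_mult_iff)
      then show ?thesis by (elim hausdorff_pre_lessE) (meson less_imp_le)
    qed
    then obtain C where C: "\<And>n. A n \<subseteq> (\<Union>i. C n i)" "\<And>n i. bounded (C n i)" "\<And>n i. diameter (C n i) \<le> \<delta>"
      "\<And>n. (\<Sum>i::nat. ?w (C n i)) \<le> hausdorff_pre s \<delta> (A n) + ennreal (e * (1/2) ^ Suc n)"
      by metis
    define D where "D i = (case prod_decode i of (n, j) \<Rightarrow> C n j)" for i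
    have "hausdorff_pre s \<delta> (\<Union>n. A n) \<le> (\<Sum>i. ?w (D i))"
    proof (rule hausdorff_pre_le)
      show "(\<Union>n. A n) \<subseteq> (\<Union>i. D i)"
      proof
        fix x assume "x \<in> (\<Union>n. A n)"
        then obtain n j where "x \<in> C n j" using C(1) by blast
        then have "x \<in> D (prod_encode (n, j))" by (simp add: D_def)
        then show "x \<in> (\<Union>i. D i)" by blast
      qed
    qed (auto simp: D_def C split: prod.split)
    also have "(\<Sum>i. ?w (D i)) = (\<Sum>i. (\<lambda>(n, j). ?w (C n j)) (prod_decode i))"
      by (simp add: D_def split_beta)
    also have "\<dots> = (\<Sum>n. \<Sum>j. ?w (C n j))"
      by (rule suminf_ennreal_2dimen) simp
    also have "\<dots> \<le> (\<Sum>n. hausdorff_pre s \<delta> (A n) + ennreal (e * (1/2) ^ Suc n))"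
      by (intro suminf_le C) auto
    also have "\<dots> = (\<Sum>n. hausdorff_pre s \<delta> (A n)) + (\<Sum>n. ennreal (e * (1/2) ^ Suc n))"
      by (rule suminf_add[symmetric]) auto
    also have "(\<Sum>n. ennreal (e * (1/2) ^ Suc n)) = ennreal e"
      using e sums_mult[OF power_half_series, of e] by (intro suminf_ennreal_eq) auto
    finally show "hausdorff_pre s \<delta> (\<Union>n. A n) \<le> (\<Sum>n. hausdorff_pre s \<delta> (A n)) + ennreal e" .
  qed
qed simp

lemma hausdorff_measure_mono: "A \<subseteq> B \<Longrightarrow> hausdorff_measure s A \<le> hausdorff_measure s B"
  unfolding hausdorff_measure_def by (intro SUP_mono' hausdorff_pre_mono)

lemma hausdorff_pre_le_measure: "0 < \<delta> \<Longrightarrow> hausdorff_pre s \<delta> A \<le> hausdorff_measure s A"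
  unfolding hausdorff_measure_def by (intro SUP_upper) simp

lemma hausdorff_measure_empty [simp]: "hausdorff_measure s {} = 0"
  unfolding hausdorff_measure_def by (auto simp: hausdorff_pre_empty SUP_eq_const)

lemma hausdorff_measure_countably_subadditive:
  fixes A :: "nat \<Rightarrow> 'a::metric_space set"
  shows "hausdorff_measure s (\<Union>n. A n) \<le> (\<Sum>n. hausdorff_measure s (A n))"
  unfolding hausdorff_measure_def[of s "\<Union>n. A n"]
proof (rule SUP_least)
  fix \<delta> :: real assume "\<delta> \<in> {0<..}"
  then show "hausdorff_pre s \<delta> (\<Union>n. A n) \<le> (\<Sum>n. hausdorff_measure s (A n))"
    by (intro order_trans[OF hausdorff_pre_countably_subadditive] suminf_le hausdorff_pre_le_measure) auto
qed

lemma outer_measure_space_hausdorff: "outer_measure_space UNIV (hausdorff_measure s)"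
  by (auto simp: outer_measure_space_def positive_def increasing_def countably_subadditive_def
      hausdorff_measure_mono hausdorff_measure_countably_subadditive)

lemma hausdorff_measure_Un: "hausdorff_measure s (A \<union> B) \<le> hausdorff_measure s A + hausdorff_measure s B"
proof -
  have "hausdorff_measure s (\<Union>n. (if n = (0::nat) then A else if n = 1 then B else {}))
    \<le> (\<Sum>n. hausdorff_measure s (if n = (0::nat) then A else if n = 1 then B else {}))"
    by (rule hausdorff_measure_countably_subadditive)
  also have "\<dots> = (\<Sum>n\<in>{0,1}. hausdorff_measure s (if n = (0::nat) then A else if n = 1 then B else {}))"
    by (rule suminf_finite) auto
  also have "\<dots> = hausdorff_measure s A + hausdorff_measure s B" by simp
  also have "(\<Union>n. (if n = (0::nat) then A else if n = 1 then B else {})) = A \<union> B"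
    by (auto split: if_splits)
  finally show ?thesis .
qed

text \<open>A set of diameter at most \<open>\<delta>\<close> cannot meet both \<open>A\<close> and
  \<open>B\<close>, so a cover of the union splits into covers of the two parts that share no
  nonempty member.\<close>

lemma hausdorff_pre_separated:
  fixes A B :: "'a::metric_space set"
  assumes sep: "\<And>x y. x \<in> A \<Longrightarrow> y \<in> B \<Longrightarrow> \<delta> < dist x y" and "0 \<le> \<delta>"
  shows "hausdorff_pre s \<delta> A + hausdorff_pre s \<delta> B \<le> hausdorff_pre s \<delta> (A \<union> B)"
  unfolding hausdorff_pre_def[of s \<delta> "A \<union> B"]
proof (rule INF_greatest)
  let ?w = "\<lambda>C :: 'a set. ennreal (omega_s s * (diameter C / 2) powr s)"
  fix C :: "nat \<Rightarrow> 'a set" assume "C \<in> {C. A \<union> B \<subseteq> (\<Union>i. C i) \<and> (\<forall>i. bounded (C i) \<and> diameter (C i) \<le> \<delta>)}"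
  then have C: "A \<union> B \<subseteq> (\<Union>i. C i)" "\<And>i. bounded (C i)" "\<And>i. diameter (C i) \<le> \<delta>" by auto
  define D where "D X i = (if C i \<inter> X = {} then {} else C i)" for X i
  have "hausdorff_pre s \<delta> X \<le> (\<Sum>i. ?w (D X i))" if "X \<subseteq> A \<union> B" for X
  proof (rule hausdorff_pre_le)
    show "X \<subseteq> (\<Union>i. D X i)"
    proof
      fix x assume x: "x \<in> X"
      with that C(1) obtain i where "x \<in> C i" by blast
      with x have "x \<in> D X i" by (auto simp: D_def)
      then show "x \<in> (\<Union>i. D X i)" by blast
    qed
  qed (use C \<open>0 \<le> \<delta>\<close> in \<open>auto simp: D_def\<close>)
  then have "hausdorff_pre s \<delta> A + hausdorff_pre s \<delta> B \<le> (\<Sum>i. ?w (D A i)) + (\<Sum>i. ?w (D B i))"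
    by (intro add_mono) auto
  also have "\<dots> = (\<Sum>i. ?w (D A i) + ?w (D B i))"
    by (rule suminf_add) auto
  also have "\<dots> \<le> (\<Sum>i. ?w (C i))"
  proof (intro suminf_le allI)
    fix i
    have "C i \<inter> A = {} \<or> C i \<inter> B = {}"
    proof (rule ccontr)
      assume "\<not> ?thesis"
      then obtain x y where "x \<in> C i" "x \<in> A" "y \<in> C i" "y \<in> B" by auto
      then show False
        using sep[of x y] diameter_bounded_bound[OF C(2)[of i], of x y] C(3)[of i] by simp
    qed
    then show "?w (D A i) + ?w (D B i) \<le> ?w (C i)" by (auto simp: D_def)
  qed auto
  finally show "hausdorff_pre s \<delta> A + hausdorff_pre s \<delta> B \<le> (\<Sum>i. ?w (C i))" .
qed

lemma hausdorff_measure_separated: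
  fixes A B :: "'a::metric_space set"
  assumes sep: "\<And>x y. x \<in> A \<Longrightarrow> y \<in> B \<Longrightarrow> \<epsilon> \<le> dist x y" and "0 < \<epsilon>"
  shows "hausdorff_measure s A + hausdorff_measure s B \<le> hausdorff_measure s (A \<union> B)"
proof -
  have "hausdorff_pre s a A + hausdorff_pre s b B \<le> hausdorff_measure s (A \<union> B)"
    if "0 < a" "0 < b" for a b
  proof -
    \<comment> \<open>Below \<open>\<epsilon>\<close> for the separation; below \<open>a\<close> and
      \<open>b\<close> because the two suprema on the left are taken independently.\<close>
    define \<delta> where "\<delta> = min (min a b) (\<epsilon> / 2)"
    have \<delta>: "0 < \<delta>" "\<delta> \<le> a" "\<delta> \<le> b" "\<delta> < \<epsilon>" using that \<open>0 < \<epsilon>\<close> by (auto simp: \<delta>_def)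
    have "hausdorff_pre s a A + hausdorff_pre s b B \<le> hausdorff_pre s \<delta> A + hausdorff_pre s \<delta> B"
      using \<delta> by (intro add_mono hausdorff_pre_antimono)
    also have "\<dots> \<le> hausdorff_pre s \<delta> (A \<union> B)"
      using \<delta> sep by (intro hausdorff_pre_separated) (auto intro: less_le_trans)
    also have "\<dots> \<le> hausdorff_measure s (A \<union> B)" using \<delta> by (intro hausdorff_pre_le_measure)
    finally show ?thesis .
  qed
  then have "hausdorff_pre s a A + hausdorff_measure s B \<le> hausdorff_measure s (A \<union> B)" if "0 < a" for a
    using that unfolding hausdorff_measure_def[of s B]
    by (subst ennreal_SUP_add_right) (auto intro!: SUP_least)
  then show ?thesis
    unfolding hausdorff_measure_def[of s A]
    by (subst ennreal_SUP_add_left[symmetric]) (auto intro!: SUP_least)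
qed

text \<open>Caratheodory's criterion: the layers \<open>R n\<close> of equal parity are separated from each other,
  so their measures are summable and the part of \<open>X - F\<close> close to \<open>F\<close> is negligible.\<close>
lemma hausdorff_measure_infdist_layers:
  fixes F X :: "'a::metric_space set"
  assumes F: "closed F" "F \<noteq> {}"
  shows "hausdorff_measure s (X \<inter> F) + hausdorff_measure s (X - F) \<le> hausdorff_measure s X"
proof (cases "hausdorff_measure s X = \<infinity>")
  case False
  let ?H = "hausdorff_measure s"
  define d where "d n = 1 / (real n + 1)" for n
  have d_pos: "0 < d n" for n by (simp add: d_def)
  have d_mono: "d m < d n" if "n < m" for m n using that by (simp add: d_def frac_less2)
  have d_le: "d m \<le> d n" if "n \<le> m" for m n using that by (simp add: d_def frac_le)
  define Y where "Y n = {x \<in> X. d n \<le> infdist x F}" for n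
  define R where "R n = {x \<in> X. d (Suc n) \<le> infdist x F \<and> infdist x F < d n}" for n
  have inf_dist: "infdist x F - infdist y F \<le> dist x y" for x y
    using infdist_triangle[of x F y] by simp
  \<comment> \<open>Adjacent layers may touch, but skipping one leaves the gap
    \<open>d (Suc n) - d (Suc (Suc n))\<close>. This is why layers of equal parity are
    summed.\<close>
  have R_sep: "?H (R (Suc (Suc n))) + ?H A \<le> ?H (R (Suc (Suc n)) \<union> A)" if "A \<subseteq> Y (Suc n)" for n A
  proof -
    have "d (Suc n) - d (Suc (Suc n)) \<le> dist x y" if "x \<in> R (Suc (Suc n))" "y \<in> A" for x y
      using that \<open>A \<subseteq> Y (Suc n)\<close> inf_dist[of y x] by (auto simp: R_def Y_def dist_commute)
    then show ?thesis
      by (rule hausdorff_measure_separated) (use d_mono[of "Suc n" "Suc (Suc n)"] in auto)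
  qed
  have bound: "(\<Sum>j<n. ?H (R (2 * j + b))) \<le> ?H (\<Union>j<n. R (2 * j + b))" for n b
  proof (induction n)
    case (Suc n)
    show ?case
    proof (cases n)
      case (Suc m)
      have sub: "(\<Union>j<n. R (2 * j + b)) \<subseteq> Y (Suc (2 * m + b))"
      proof
        fix x assume "x \<in> (\<Union>j<n. R (2 * j + b))"
        then obtain j where j: "j < n" "x \<in> R (2 * j + b)" by blast
        then have "d (Suc (2 * m + b)) \<le> d (Suc (2 * j + b))" using Suc by (intro d_le) auto
        with j show "x \<in> Y (Suc (2 * m + b))" by (auto simp: R_def Y_def)
      qed
      have "(\<Sum>j<Suc n. ?H (R (2 * j + b))) \<le> ?H (R (2 * n + b)) + ?H (\<Union>j<n. R (2 * j + b))"
        using Suc.IH by (simp add: add.commute add_left_mono)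
      also have "\<dots> \<le> ?H (R (2 * n + b) \<union> (\<Union>j<n. R (2 * j + b)))"
        using R_sep[OF sub] Suc by simp
      also have "R (2 * n + b) \<union> (\<Union>j<n. R (2 * j + b)) = (\<Union>j<Suc n. R (2 * j + b))"
        by (auto simp: lessThan_Suc)
      finally show ?thesis .
    qed (simp add: lessThan_Suc)
  qed simp
  have fin: "(\<Sum>j. ?H (R (2 * j + b))) \<le> ?H X" for b
  proof (rule suminf_le_const)
    fix n
    show "(\<Sum>j<n. ?H (R (2 * j + b))) \<le> ?H X"
      by (rule order_trans[OF bound hausdorff_measure_mono]) (auto simp: R_def)
  qed simp
  have parity: "(\<Sum>j<2 * n. ?H (R j)) = (\<Sum>j<n. ?H (R (2 * j + 0))) + (\<Sum>j<n. ?H (R (2 * j + 1)))" for n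
    by (induction n) (auto simp: algebra_simps)
  have total: "(\<Sum>j. ?H (R j)) \<le> ?H X + ?H X"
  proof (rule suminf_le_const)
    fix n
    have "(\<Sum>j<n. ?H (R j)) \<le> (\<Sum>j<2 * n. ?H (R j))"
      by (intro sum_mono2) auto
    also have "\<dots> \<le> ?H X + ?H X"
      unfolding parity
      by (intro add_mono order_trans[OF sum_le_suminf[OF summableI] fin]) auto
    finally show "(\<Sum>j<n. ?H (R j)) \<le> ?H X + ?H X" .
  qed simp
  then have "(\<Sum>j. ?H (R j)) \<noteq> \<infinity>"
    using False by (metis ennreal_add_eq_top infinity_ennreal_def neq_top_trans)
  then have tail: "(\<lambda>n. \<Sum>j. ?H (R (j + n))) \<longlonglongrightarrow> 0"
  proof -
    assume fin: "(\<Sum>j. ?H (R j)) \<noteq> \<infinity>"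
    have split: "(\<Sum>j. ?H (R (j + n))) = (\<Sum>j. ?H (R j)) - (\<Sum>j<n. ?H (R j))" for n
    proof -
      have "(\<Sum>j<n. ?H (R j)) \<noteq> \<infinity>"
        using fin sum_le_suminf[of "\<lambda>j. ?H (R j)" "{..<n}"]
        by (metis finite_lessThan infinity_ennreal_def neq_top_trans summableI zero_le)
      then show ?thesis
        by (subst suminf_offset[of "\<lambda>j. ?H (R j)" n]) (auto simp: ennreal_add_diff_cancel)
    qed
    have "(\<lambda>n. (\<Sum>j. ?H (R j)) - (\<Sum>j<n. ?H (R j))) \<longlonglongrightarrow> (\<Sum>j. ?H (R j)) - (\<Sum>j. ?H (R j))"
      using fin by (intro tendsto_diff_ennreal_general tendsto_const summable_LIMSEQ) auto
    then show ?thesis using fin by (simp add: split)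
  qed
  \<comment> \<open>A point outside the closed set \<open>F\<close> has positive distance to it, so
    it lies in \<open>Y n\<close> or in a layer of index at least \<open>n\<close>. The error is a
    tail of a convergent series.\<close>
  have step: "?H (X \<inter> F) + ?H (X - F) \<le> ?H X + (\<Sum>j. ?H (R (j + n)))" for n
  proof -
    have "X - F \<subseteq> Y n \<union> (\<Union>j. R (j + n))"
    proof
      fix x assume x: "x \<in> X - F"
      then have pos: "0 < infdist x F"
        using F by (metis DiffD2 in_closed_iff_infdist_zero infdist_nonneg less_eq_real_def)
      show "x \<in> Y n \<union> (\<Union>j. R (j + n))"
      proof (cases "d n \<le> infdist x F")
        case True
        then show ?thesis using x by (auto simp: Y_def)
      next
        case False
        obtain m where "inverse (real (Suc m)) < infdist x F"
          using pos reals_Archimedean by blast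
        then have ex: "d m \<le> infdist x F" by (simp add: d_def inverse_eq_divide add.commute)
        define l where "l = (LEAST m. d m \<le> infdist x F)"
        have l: "d l \<le> infdist x F" unfolding l_def using ex by (rule LeastI)
        have "n < l"
          by (rule ccontr) (use d_le[of l n] l False in auto)
        then obtain i where i: "l = Suc (i + n)" using less_imp_Suc_add by (metis add.commute add_Suc_right)
        have "infdist x F < d (i + n)"
          using not_less_Least[of "i + n" "\<lambda>m. d m \<le> infdist x F"] i unfolding l_def by simp
        then have "x \<in> R (i + n)" using x l i by (auto simp: R_def)
        then show ?thesis by blast
      qed
    qed
    then have "?H (X - F) \<le> ?H (Y n) + ?H (\<Union>j. R (j + n))"
      by (meson hausdorff_measure_mono hausdorff_measure_Un order_trans)
    also have "\<dots> \<le> ?H (Y n) + (\<Sum>j. ?H (R (j + n)))"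
      by (intro add_left_mono hausdorff_measure_countably_subadditive)
    finally have "?H (X \<inter> F) + ?H (X - F) \<le> (?H (X \<inter> F) + ?H (Y n)) + (\<Sum>j. ?H (R (j + n)))"
      by (simp add: add.assoc add_left_mono)
    also have "?H (X \<inter> F) + ?H (Y n) \<le> ?H (X \<inter> F \<union> Y n)"
    proof (rule hausdorff_measure_separated[OF _ d_pos[of n]])
      fix x y assume "x \<in> X \<inter> F" "y \<in> Y n"
      then show "d n \<le> dist x y" using inf_dist[of y x] F
        by (auto simp: Y_def dist_commute)
    qed
    also have "\<dots> \<le> ?H X" by (rule hausdorff_measure_mono) (auto simp: Y_def)
    finally show ?thesis by (simp add: add_right_mono)
  qed
  have "(\<lambda>n. ?H X + (\<Sum>j. ?H (R (j + n)))) \<longlonglongrightarrow> ?H X + 0"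
    by (intro tendsto_add tail tendsto_const)
  then show ?thesis
    using step by (intro LIMSEQ_le_const[of _ "?H X"]) auto
qed simp

text \<open>Closed sets satisfy Caratheodory's condition by the layer argument, and the sets that
  satisfy it form a \<sigma>-algebra on which the outer measure is countably additive.\<close>

theorem measure_space_hausdorff_borel:
  "measure_space (UNIV :: 'a::metric_space set) (sets borel) (hausdorff_measure s)"
proof -
  interpret sigma_algebra "UNIV :: 'a set" "Pow UNIV" by (rule sigma_algebra_Pow)
  let ?L = "lambda_system (UNIV :: 'a set) (Pow UNIV) (hausdorff_measure s)"
  have ms: "measure_space UNIV ?L (hausdorff_measure s)"
    using caratheodory_lemma[of "hausdorff_measure s"] outer_measure_space_hausdorff[of s] by simp
  then interpret L: sigma_algebra UNIV ?L by (simp add: measure_space_def)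
  have closed: "F \<in> ?L" if "closed F" for F
  proof (cases "F = {}")
    case True
    then show ?thesis using L.empty_sets by metis
  next
    case False
    have "hausdorff_measure s (X \<inter> F) + hausdorff_measure s (X - F) = hausdorff_measure s X" for X
      using hausdorff_measure_infdist_layers[OF that False, of s X]
        hausdorff_measure_Un[of s "X \<inter> F" "X - F"]
      by (simp add: Int_Diff_Un antisym)
    moreover have "F \<inter> X = X \<inter> F" "(UNIV - F) \<inter> X = X - F" for X by auto
    ultimately show ?thesis by (simp add: lambda_system_def)
  qed
  have "U \<in> ?L" if "open U" for U
    using L.compl_sets[OF closed[OF closed_Compl[OF that]]] by (simp flip: Compl_eq_Diff_UNIV)
  then have "sigma_sets UNIV {U. open U} \<subseteq> ?L"
    by (intro L.sigma_sets_subset) blast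
  then have "sets borel \<subseteq> ?L" by (simp add: borel_def)
  then show ?thesis
    using ms by (auto simp: measure_space_def positive_def countably_additive_def
        sets.sigma_algebra_axioms[of borel, simplified] subset_eq)
qed

section \<open>Hausdorff measure of the sphere\<close>

text \<open>An arbitrary index set replaces the ranks of \<open>sphere_k\<close>: the geometry sees
  only \<open>card I\<close>.\<close>

definition coord_sphere :: "'n::finite set \<Rightarrow> (real^'n) set" where
  "coord_sphere I = {x. (\<forall>i. i \<notin> I \<longrightarrow> x $ i = 0) \<and> norm x = 1}"

lemma sum_squares_coord_subspace:
  fixes x :: "real^'n"
  assumes "\<And>i. i \<notin> I \<Longrightarrow> x $ i = 0"
  shows "(\<Sum>i\<in>I. (x $ i)\<^sup>2) = (norm x)\<^sup>2"
proof -
  have "(norm x)\<^sup>2 = (\<Sum>i\<in>UNIV. (x $ i)\<^sup>2)"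
    unfolding power2_norm_eq_inner inner_vec_def by (simp add: power2_eq_square)
  also have "\<dots> = (\<Sum>i\<in>I. (x $ i)\<^sup>2)"
    using assms by (intro sum.mono_neutral_right) auto
  finally show ?thesis by simp
qed

lemma omega_s_pos: "0 \<le> s \<Longrightarrow> 0 < omega_s s"
  by (simp add: omega_s_def)

lemma hausdorff_pre_finite_cover:
  fixes A :: "'a::real_normed_vector set"
  assumes J: "finite J" "A \<subseteq> (\<Union>j\<in>J. C j)"
    and C: "\<And>j x y. j \<in> J \<Longrightarrow> x \<in> C j \<Longrightarrow> y \<in> C j \<Longrightarrow> dist x y \<le> D"
    and "0 \<le> D" "D \<le> \<delta>" "0 \<le> s"
  shows "hausdorff_pre s \<delta> A \<le> ennreal (real (card J) * (omega_s s * (D / 2) powr s))"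
proof -
  obtain h where h: "bij_betw h {..<card J} J"
    using ex_bij_betw_nat_finite[OF J(1)] by (auto simp: atLeast0LessThan)
  define B where "B i = (if i < card J then C (h i) else {})" for i
  have bdd: "bounded (B i)" for i
  proof (cases "B i = {}")
    case False
    then obtain a where "a \<in> B i" by blast
    then show ?thesis
      unfolding bounded_def using C bij_betwE[OF h]
      by (intro exI[of _ a] exI[of _ D]) (auto simp: B_def split: if_splits)
  qed simp
  have diam: "diameter (B i) \<le> D" for i
    using C bij_betwE[OF h] \<open>0 \<le> D\<close> by (intro diameter_le) (auto simp: B_def simp flip: dist_norm split: if_splits)
  have "A \<subseteq> (\<Union>i. B i)"
  proof
    fix x assume "x \<in> A"
    then obtain j where j: "j \<in> J" "x \<in> C j" using J by blast
    then obtain i where "i < card J" "h i = j" using h by (force simp: bij_betw_def)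
    then show "x \<in> (\<Union>i. B i)" using j by (auto simp: B_def)
  qed
  then have "hausdorff_pre s \<delta> A \<le> (\<Sum>i. ennreal (omega_s s * (diameter (B i) / 2) powr s))"
    using bdd diam \<open>D \<le> \<delta>\<close> by (intro hausdorff_pre_le) (auto intro: order_trans)
  \<comment> \<open>The empty sets that pad the cover cost nothing: their diameter is 0, and
    \<open>0 powr s = 0\<close> for every \<open>s\<close>.\<close>
  also have "\<dots> = (\<Sum>i<card J. ennreal (omega_s s * (diameter (B i) / 2) powr s))"
    by (rule suminf_finite) (auto simp: B_def)
  also have "\<dots> \<le> (\<Sum>i<card J. ennreal (omega_s s * (D / 2) powr s))"
    using diam bdd omega_s_pos[OF \<open>0 \<le> s\<close>] \<open>0 \<le> s\<close>
    by (intro sum_mono ennreal_leI mult_left_mono powr_mono2) (auto simp: diameter_ge_0)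
  also have "\<dots> = ennreal (real (card J) * (omega_s s * (D / 2) powr s))"
    by (simp add: ennreal_mult'' ennreal_of_nat_eq_real_of_nat omega_s_pos[OF \<open>0 \<le> s\<close>] less_imp_le)
  finally show ?thesis .
qed

text \<open>On the cap where \<open>\<sigma> x\<^sub>i\<close> is bounded below, the sphere is a Lipschitz graph over
  the remaining coordinates of \<open>I\<close>.\<close>
lemma coord_sphere_cap_dist_le:
  fixes y z :: "real^'n"
  assumes "y \<in> coord_sphere I" "z \<in> coord_sphere I" "i \<in> I"
    and \<sigma>: "\<sigma> = 1 \<or> \<sigma> = -1" and m: "m = real (card I)"
    and cap: "1 / m \<le> \<sigma> * y $ i" "1 / m \<le> \<sigma> * z $ i"
    and h: "\<And>j. j \<in> I - {i} \<Longrightarrow> \<bar>y $ j - z $ j\<bar> \<le> h"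
  shows "dist y z \<le> m * (1 + m) * max h 0"
proof -
  let ?J = "I - {i}" and ?h = "max h 0"
  have fin: "finite I" by simp
  have m1: "1 \<le> m" using \<open>i \<in> I\<close> fin m by (metis One_nat_def Suc_leI card_gt_0_iff empty_iff of_nat_1 of_nat_le_iff)
  have cardJ: "real (card ?J) \<le> m" using m \<open>i \<in> I\<close> by (simp add: card_Diff_singleton)
  have sum1: "(\<Sum>j\<in>?J. (x $ j)\<^sup>2) = 1 - (x $ i)\<^sup>2" if "x \<in> coord_sphere I" for x
    using sum_squares_coord_subspace[of I x] that \<open>i \<in> I\<close> fin
    by (simp add: coord_sphere_def sum_diff1)
  have le1: "\<bar>x $ j\<bar> \<le> 1" if "x \<in> coord_sphere I" for x and j
    using component_le_norm_cart[of x j] that by (simp add: coord_sphere_def)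
  \<comment> \<open>Both points have norm 1, so the difference of squares in coordinate
    \<open>i\<close> is the negative of its sum over the other coordinates.\<close>
  have "\<bar>(y $ i - z $ i) * (y $ i + z $ i)\<bar> = \<bar>\<Sum>j\<in>?J. (z $ j - y $ j) * (z $ j + y $ j)\<bar>"
    using sum1[OF assms(1)] sum1[OF assms(2)]
    by (simp add: sum_subtractf algebra_simps power2_eq_square)
  also have "\<dots> \<le> (\<Sum>j\<in>?J. \<bar>(z $ j - y $ j) * (z $ j + y $ j)\<bar>)" by (rule sum_abs)
  also have "\<dots> \<le> (\<Sum>j\<in>?J. ?h * 2)"
  proof (rule sum_mono)
    fix j assume "j \<in> ?J"
    then have "\<bar>z $ j - y $ j\<bar> \<le> ?h" using h[of j] by (simp add: abs_minus_commute)
    moreover have "\<bar>z $ j + y $ j\<bar> \<le> 2" using le1[OF assms(1), of j] le1[OF assms(2), of j] by linarith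
    ultimately show "\<bar>(z $ j - y $ j) * (z $ j + y $ j)\<bar> \<le> ?h * 2"
      unfolding abs_mult by (intro mult_mono) auto
  qed
  also have "\<dots> \<le> m * (?h * 2)" using cardJ by (simp add: mult_right_mono)
  finally have prod: "\<bar>y $ i - z $ i\<bar> * \<bar>y $ i + z $ i\<bar> \<le> m * (?h * 2)" by (simp add: abs_mult)
  \<comment> \<open>\<open>y $ i\<close> and \<open>z $ i\<close> share the sign
    \<open>\<sigma>\<close>, so their sum stays away from 0 and the bound on the product bounds the
    difference.\<close>
  have "2 / m \<le> \<bar>y $ i + z $ i\<bar>" using cap \<sigma> by auto
  then have "\<bar>y $ i - z $ i\<bar> * (2 / m) \<le> m * (?h * 2)"
    using prod mult_left_mono[of "2 / m" "\<bar>y $ i + z $ i\<bar>" "\<bar>y $ i - z $ i\<bar>"] by linarith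
  then have i_le: "\<bar>y $ i - z $ i\<bar> \<le> m * m * ?h" using m1 by (simp add: field_simps)
  have "dist y z \<le> (\<Sum>j\<in>UNIV. \<bar>(y - z) $ j\<bar>)" unfolding dist_norm by (rule norm_le_l1_cart)
  also have "\<dots> = (\<Sum>j\<in>I. \<bar>y $ j - z $ j\<bar>)"
    using assms(1,2) by (intro sum.mono_neutral_cong_right) (auto simp: coord_sphere_def)
  also have "\<dots> = \<bar>y $ i - z $ i\<bar> + (\<Sum>j\<in>?J. \<bar>y $ j - z $ j\<bar>)"
    using \<open>i \<in> I\<close> fin by (rule sum.remove[rotated])
  also have "(\<Sum>j\<in>?J. \<bar>y $ j - z $ j\<bar>) \<le> (\<Sum>j\<in>?J. ?h)" using h by (intro sum_mono) (simp add: max.coboundedI1)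
  also have "\<dots> \<le> m * ?h" using cardJ by (simp add: mult_right_mono)
  finally show ?thesis using i_le by (simp add: algebra_simps)
qed

text \<open>With \<open>m = card I\<close>, if every coordinate in \<open>I\<close> were below
  \<open>1/m\<close> in modulus, the squares would sum to less than
  \<open>m * (1/m)^2 \<le> 1\<close>.\<close>

lemma coord_sphere_cap_cover:
  fixes y :: "real^'n"
  assumes "y \<in> coord_sphere I"
  obtains i \<sigma> where "i \<in> I" "\<sigma> \<in> {1, -1}" "1 / real (card I) \<le> \<sigma> * y $ i"
proof -
  let ?m = "real (card I)"
  have sum: "(\<Sum>i\<in>I. (y $ i)\<^sup>2) = 1"
    using sum_squares_coord_subspace[of I y] assms by (simp add: coord_sphere_def)
  then have "card I \<noteq> 0" by auto
  then have m: "1 \<le> ?m" by linarith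
  have "\<exists>i\<in>I. 1 / ?m \<le> \<bar>y $ i\<bar>"
  proof (rule ccontr)
    assume "\<not> ?thesis"
    then have "\<bar>y $ i\<bar> < 1 / ?m" if "i \<in> I" for i using that by force
    then have "(y $ i)\<^sup>2 < (1 / ?m)\<^sup>2" if "i \<in> I" for i
      using that by (metis abs_ge_zero power2_abs power_strict_mono zero_less_numeral)
    then have "(\<Sum>i\<in>I. (y $ i)\<^sup>2) < (\<Sum>i\<in>I. (1 / ?m)\<^sup>2)"
      using \<open>card I \<noteq> 0\<close> by (intro sum_strict_mono) auto
    also have "\<dots> \<le> 1" using m by (simp add: power2_eq_square)
    finally show False using sum by simp
  qed
  then obtain i where "i \<in> I" "1 / ?m \<le> \<bar>y $ i\<bar>" by blast
  then show ?thesis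
    by (intro that[of i "if 0 \<le> y $ i then 1 else -1"]) auto
qed

text \<open>Each of the \<open>2 * m\<close> caps is cut along a grid of \<open>M ^ k\<close> cubes
  of side \<open>2 * r / M\<close> in the remaining coordinates. By the Lipschitz bound a piece has
  diameter at most \<open>L\<close> times the side, so the powers of \<open>M\<close> cancel in the
  sum and \<open>M\<close> is free to make the pieces small.\<close>

lemma hausdorff_coord_sphere_ball:
  fixes I :: "'n::finite set"
  assumes card: "card I = k + 1" and k: "1 \<le> k"
  obtains K where "0 \<le> K"
    "\<And>x r. 0 < r \<Longrightarrow> hausdorff_measure (real k) (coord_sphere I \<inter> ball x r) \<le> ennreal (K * r ^ k)"
proof -
  define m where "m = real (card I)"
  define L where "L = m * (1 + m)"
  define K where "K = 2 * m * (omega_s (real k) * L ^ k)"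
  have m: "2 \<le> m" using card k by (simp add: m_def)
  have L: "0 < L" using m by (simp add: L_def)
  have om: "0 < omega_s (real k)" by (simp add: omega_s_pos)
  have K: "0 \<le> K" using m L om by (simp add: K_def)
  have "hausdorff_measure (real k) (coord_sphere I \<inter> ball x r) \<le> ennreal (K * r ^ k)" if r: "0 < r"
    for x :: "real^'n" and r
    unfolding hausdorff_measure_def
  proof (rule SUP_least)
    fix \<delta> :: real assume \<delta>: "\<delta> \<in> {0<..}"
    \<comment> \<open>Chosen so that the piece diameter \<open>D = 2 * L * r / M\<close> is at most
      \<open>\<delta>\<close>.\<close>
    obtain M0 :: nat where M0: "2 * L * r / \<delta> < real M0" using reals_Archimedean2 by blast
    define M where "M = Suc M0"
    have M: "0 < M" "2 * L * r / \<delta> < real M" using M0 by (auto simp: M_def)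
    define h where "h = 2 * r / real M"
    have h: "0 < h" using r M by (simp add: h_def)
    define D where "D = L * h"
    have D: "0 \<le> D" "D \<le> \<delta>" using L h M \<delta> by (auto simp: D_def h_def field_simps)
    \<comment> \<open>A piece is named by its cap (coordinate \<open>i\<close>, sign
      \<open>\<sigma>\<close>) and by its grid cell \<open>g\<close> in the other \<open>k\<close>
      coordinates.\<close>
    define N where "N = (SIGMA i : I. {1, -1 :: real} \<times> PiE (I - {i}) (\<lambda>_. {..<M}))"
    define C where "C = (\<lambda>(i, \<sigma>, g). {y \<in> coord_sphere I \<inter> ball x r. 1 / m \<le> \<sigma> * y $ i \<and>
        (\<forall>j\<in>I - {i}. real (g j) \<le> (y $ j - x $ j + r) / h \<and> (y $ j - x $ j + r) / h \<le> real (g j) + 1)})"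
    have finN: "finite N" unfolding N_def by (intro finite_SigmaI finite_cartesian_product finite_PiE) auto
    have "card N = (\<Sum>i\<in>I. 2 * M ^ k)"
      unfolding N_def using card
      by (subst card_SigmaI) (auto simp: card_cartesian_product card_PiE finite_PiE card_Diff_singleton intro!: sum.cong)
    then have cardN: "real (card N) = 2 * m * real M ^ k" by (simp add: m_def)
    have "hausdorff_pre (real k) \<delta> (coord_sphere I \<inter> ball x r)
        \<le> ennreal (real (card N) * (omega_s (real k) * (D / 2) powr real k))"
    proof (rule hausdorff_pre_finite_cover[OF finN _ _ D])
      show "coord_sphere I \<inter> ball x r \<subseteq> (\<Union>c\<in>N. C c)"
      proof
        fix y assume y: "y \<in> coord_sphere I \<inter> ball x r"
        then obtain i \<sigma> where i: "i \<in> I" "\<sigma> \<in> {1, -1 :: real}" "1 / m \<le> \<sigma> * y $ i"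
          using coord_sphere_cap_cover[of y I] unfolding m_def by blast
        define q where "q j = (y $ j - x $ j + r) / h" for j
        define g where "g = restrict (\<lambda>j. nat \<lfloor>q j\<rfloor>) (I - {i})"
        have q: "0 \<le> q j \<and> q j < real M" for j
        proof -
          have "\<bar>x $ j - y $ j\<bar> < r"
            using component_le_norm_cart[of "x - y" j] y by (simp add: dist_norm)
          then have "0 < y $ j - x $ j + r" "y $ j - x $ j + r < 2 * r" by linarith+
          moreover have "real M * h = 2 * r" using M by (simp add: h_def)
          ultimately show ?thesis using h by (simp add: q_def pos_divide_less_eq)
        qed
        have "nat \<lfloor>q j\<rfloor> < M" "real (nat \<lfloor>q j\<rfloor>) \<le> q j" "q j \<le> real (nat \<lfloor>q j\<rfloor>) + 1" for j
          using q[of j] by (auto simp: nat_less_iff floor_less_iff)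
        then have "(i, \<sigma>, g) \<in> N" "y \<in> C (i, \<sigma>, g)"
          using i y by (auto simp: N_def C_def g_def q_def[symmetric])
        then show "y \<in> (\<Union>c\<in>N. C c)" by blast
      qed
    next
      fix c y z assume c: "c \<in> N" "y \<in> C c" "z \<in> C c"
      obtain i \<sigma> g where [simp]: "c = (i, \<sigma>, g)" by (cases c)
      have "\<bar>y $ j - z $ j\<bar> \<le> h" if "j \<in> I - {i}" for j
      proof -
        have "real (g j) \<le> (y $ j - x $ j + r) / h" "(y $ j - x $ j + r) / h \<le> real (g j) + 1"
          "real (g j) \<le> (z $ j - x $ j + r) / h" "(z $ j - x $ j + r) / h \<le> real (g j) + 1"
          using c that by (auto simp: C_def)
        then have "\<bar>(y $ j - x $ j + r) / h - (z $ j - x $ j + r) / h\<bar> \<le> 1" by linarith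
        then show ?thesis using h by (simp add: diff_divide_distrib[symmetric] abs_divide)
      qed
      then have "dist y z \<le> m * (1 + m) * max h 0"
        using c by (intro coord_sphere_cap_dist_le[of y I z i \<sigma> m h]) (auto simp: C_def N_def m_def)
      then show "dist y z \<le> D" using h by (simp add: D_def L_def)
    qed simp
    also have "real (card N) * (omega_s (real k) * (D / 2) powr real k) = K * r ^ k"
    proof -
      have "(D / 2) powr real k = (L * r / real M) ^ k"
        using L h M r by (simp add: powr_realpow D_def h_def)
      then show ?thesis using M cardN by (simp add: K_def power_divide power_mult_distrib)
    qed
    finally show "hausdorff_pre (real k) \<delta> (coord_sphere I \<inter> ball x r) \<le> ennreal (K * r ^ k)" .
  qed
  with K show ?thesis using that by blast
qed

lemma emeasure_lborel_box_cart:
  fixes a b :: "real^'n"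
  assumes "\<And>i. a $ i \<le> b $ i"
  shows "emeasure lborel (cbox a b) = ennreal (\<Prod>i\<in>UNIV. b $ i - a $ i)"
proof -
  have B: "(Basis :: (real^'n) set) = (\<lambda>i. axis i 1) ` UNIV" by (auto simp: Basis_vec_def)
  have "inj (\<lambda>i. axis i (1::real) :: real^'n)" by (auto simp: inj_def axis_eq_axis)
  then show ?thesis
    using assms by (subst emeasure_lborel_cbox) (auto simp: B prod.reindex inner_axis)
qed

text \<open>Projecting a cover to the coordinates other than \<open>i\<close> and thickening it to full dimension
  turns the lower bound into one for Lebesgue measure.\<close>
lemma hausdorff_coord_sphere_pos:
  fixes I :: "'n::finite set"
  assumes card: "card I = k + 1" and k: "1 \<le> k"
  shows "0 < hausdorff_measure (real k) (coord_sphere I)"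
proof -
  obtain i where i: "i \<in> I" using card by fastforce
  define J where "J = I - {i}"
  have J: "card J = k" using i card by (simp add: J_def card_Diff_singleton)
  \<comment> \<open>Half-width \<open>t\<close> in the \<open>k\<close> directions of
    \<open>J\<close> and the interval from -1 to 1 in all others: a full-dimensional set whose
    volume scales like \<open>t ^ k\<close>.\<close>
  define box where "box c t = cbox (\<chi> j. if j \<in> J then c $ j - t else -1) (\<chi> j. if j \<in> J then c $ j + t else (1::real))"
    for c :: "real^'n" and t :: real
  have vol: "emeasure lborel (box c t) = ennreal (2 ^ CARD('n) * t ^ k)" if "0 \<le> t" for c t
  proof -
    have "emeasure lborel (box c t) = ennreal (\<Prod>j\<in>UNIV. 2 * (if j \<in> J then t else 1))"
      unfolding box_def using that by (subst emeasure_lborel_box_cart) (auto intro!: arg_cong[of _ _ ennreal] prod.cong)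
    also have "(\<Prod>j\<in>UNIV. 2 * (if j \<in> J then t else 1)) = 2 ^ CARD('n) * t ^ k"
      using J by (simp add: prod.distrib prod.If_cases)
    finally show ?thesis .
  qed
  \<comment> \<open>Small enough that \<open>k * t^2 \<le> 1\<close>: every point of the cube of
    half-width \<open>t\<close> in the \<open>J\<close> directions then lifts to the sphere by a
    square root in coordinate \<open>i\<close>.\<close>
  define t where "t = 1 / (real k + 1)"
  have t: "0 < t" "real k * t\<^sup>2 \<le> 1"
  proof -
    show "0 < t" by (simp add: t_def)
    have "real k * t \<le> 1" "t \<le> 1" by (auto simp: t_def field_simps)
    then show "real k * t\<^sup>2 \<le> 1"
      using mult_mono[of "real k * t" 1 t 1] \<open>0 < t\<close> by (simp add: power2_eq_square mult.assoc)
  qed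
  define c0 where "c0 = omega_s (real k) * (t / 2) ^ k"
  have om: "0 < omega_s (real k)" by (simp add: omega_s_pos)
  have "ennreal c0 \<le> hausdorff_pre (real k) 1 (coord_sphere I)"
    unfolding hausdorff_pre_def
  proof (rule INF_greatest)
    fix C :: "nat \<Rightarrow> (real^'n) set"
    assume "C \<in> {C. coord_sphere I \<subseteq> (\<Union>i. C i) \<and> (\<forall>i. bounded (C i) \<and> diameter (C i) \<le> 1)}"
    then have C: "coord_sphere I \<subseteq> (\<Union>i. C i)" "\<And>i. bounded (C i)" by auto
    define a where "a l = (SOME y. y \<in> C l)" for l
    have a: "a l \<in> C l" if "y \<in> C l" for y l unfolding a_def using that by (rule someI)
    \<comment> \<open>The centre is an arbitrary member of \<open>C l\<close>, so the half-width has
      to be the whole diameter; this costs only a constant. For an empty \<open>C l\<close> the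
      half-width is 0.\<close>
    define T where "T l = box (a l) (diameter (C l))" for l
    have "box 0 t \<subseteq> (\<Union>l. T l)"
    proof
      fix y assume y: "y \<in> box 0 t"
      have yJ: "\<bar>y $ j\<bar> \<le> t" if "j \<in> J" for j
        using y that by (auto simp: box_def mem_box_cart abs_le_iff dest: spec[of _ j])
      have yC: "\<bar>y $ j\<bar> \<le> 1" if "j \<notin> J" for j
        using y that by (auto simp: box_def mem_box_cart abs_le_iff dest: spec[of _ j])
      have "(\<Sum>j\<in>J. (y $ j)\<^sup>2) \<le> (\<Sum>j\<in>J. t\<^sup>2)"
        using yJ by (intro sum_mono) (metis abs_ge_zero power2_abs power_mono)
      then have s1: "(\<Sum>j\<in>J. (y $ j)\<^sup>2) \<le> 1" using t J by simp
      define x :: "real^'n" where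
        "x = (\<chi> j. if j \<in> J then y $ j else if j = i then sqrt (1 - (\<Sum>j\<in>J. (y $ j)\<^sup>2)) else 0)"
      have x0: "x $ j = 0" if "j \<notin> I" for j using that i by (auto simp: x_def J_def)
      have "(\<Sum>j\<in>I. (x $ j)\<^sup>2) = (x $ i)\<^sup>2 + (\<Sum>j\<in>J. (x $ j)\<^sup>2)"
        unfolding J_def using i by (intro sum.remove) auto
      also have "\<dots> = 1" using s1 by (simp add: x_def J_def)
      finally have "(norm x)\<^sup>2 = 1" using sum_squares_coord_subspace[OF x0] by simp
      then have "norm x = 1" by (metis norm_ge_zero one_power2 power2_eq_imp_eq zero_le_one)
      then have "x \<in> coord_sphere I" using x0 by (simp add: coord_sphere_def)
      then obtain l where l: "x \<in> C l" using C by blast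
      have "\<bar>y $ j - a l $ j\<bar> \<le> diameter (C l)" if "j \<in> J" for j
      proof -
        have "\<bar>y $ j - a l $ j\<bar> = \<bar>(x - a l) $ j\<bar>" using that by (simp add: x_def)
        also have "\<dots> \<le> dist x (a l)" unfolding dist_norm by (rule component_le_norm_cart)
        also have "\<dots> \<le> diameter (C l)" using diameter_bounded_bound[OF C(2) l a[OF l]] .
        finally show ?thesis .
      qed
      then have "y \<in> T l" using yC by (auto simp: T_def box_def mem_box_cart abs_le_iff algebra_simps)
      then show "y \<in> (\<Union>l. T l)" by blast
    qed
    then have "emeasure lborel (box 0 t) \<le> emeasure lborel (\<Union>l. T l)"
      by (intro emeasure_mono) (auto simp: T_def box_def)
    also have "\<dots> \<le> (\<Sum>l. emeasure lborel (T l))"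
      by (intro emeasure_subadditive_countably) (auto simp: T_def box_def)
    also have "\<dots> = (\<Sum>l. ennreal (2 ^ CARD('n) * diameter (C l) ^ k))"
      unfolding T_def using C(2) by (subst vol) (auto simp: diameter_ge_0)
    finally have le: "ennreal (2 ^ CARD('n) * t ^ k) \<le> (\<Sum>l. ennreal (2 ^ CARD('n) * diameter (C l) ^ k))"
      using t by (simp add: vol)
    \<comment> \<open>Converts the volume \<open>2 ^ CARD('n) * diameter ^ k\<close> of a box into
      the corresponding summand of the Hausdorff pre-measure.\<close>
    define w where "w = omega_s (real k) / 2 ^ k / 2 ^ CARD('n)"
    have w: "0 \<le> w" using om by (simp add: w_def)
    have "ennreal c0 = ennreal w * ennreal (2 ^ CARD('n) * t ^ k)"
      using w t by (subst ennreal_mult'[symmetric]) (auto simp: w_def c0_def power_divide)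
    also have "\<dots> \<le> ennreal w * (\<Sum>l. ennreal (2 ^ CARD('n) * diameter (C l) ^ k))"
      by (intro mult_left_mono le) simp
    also have "\<dots> = (\<Sum>l. ennreal w * ennreal (2 ^ CARD('n) * diameter (C l) ^ k))"
      by simp
    also have "\<dots> = (\<Sum>l. ennreal (omega_s (real k) * (diameter (C l) / 2) powr real k))"
    proof (intro suminf_cong)
      fix l
      have "(diameter (C l) / 2) powr real k = (diameter (C l) / 2) ^ k"
        using k diameter_ge_0[OF C(2)] by (intro powr_realpow') auto
      then show "ennreal w * ennreal (2 ^ CARD('n) * diameter (C l) ^ k)
          = ennreal (omega_s (real k) * (diameter (C l) / 2) powr real k)"
        using w by (subst ennreal_mult'[symmetric]) (auto simp: w_def power_divide)
    qed
    finally show "ennreal c0 \<le> (\<Sum>l. ennreal (omega_s (real k) * (diameter (C l) / 2) powr real k))" .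
  qed
  also have "\<dots> \<le> hausdorff_measure (real k) (coord_sphere I)" by (rule hausdorff_pre_le_measure) simp
  finally have "ennreal c0 \<le> hausdorff_measure (real k) (coord_sphere I)" .
  moreover have "0 < c0" using om t by (simp add: c0_def)
  ultimately show ?thesis by (metis ennreal_less_zero_iff less_le_trans)
qed

section \<open>Second-order equations and differentiation under the integral\<close>

text \<open>With \<open>u = r\<^bsup>k/2\<^esup> \<phi>\<close> the equation becomes \<open>u'' = (\<kappa>/r\<^sup>2 - w\<^sup>2) u\<close>, so that the energy
  \<open>E = u'\<^sup>2 + w\<^sup>2 u\<^sup>2\<close> satisfies \<open>|E'| \<le> |\<kappa>| E/r\<^sup>2\<close>. By the mean value theorem \<open>u\<close> cannot be small
  on a whole unit interval, as then both \<open>u\<close> and some \<open>u'(z)\<close> would be small.\<close>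
lemma oscillation_lower_bound:
  fixes \<phi> \<phi>' \<phi>'' :: "real \<Rightarrow> real" and k w :: real
  assumes d1: "\<And>r. 0 < r \<Longrightarrow> (\<phi> has_real_derivative \<phi>' r) (at r)"
    and d2: "\<And>r. 0 < r \<Longrightarrow> (\<phi>' has_real_derivative \<phi>'' r) (at r)"
    and ode: "\<And>r. 0 < r \<Longrightarrow> r * (\<phi>'' r + w\<^sup>2 * \<phi> r) + k * \<phi>' r = 0"
    and w: "1 \<le> w" and r0: "0 < r0" "\<phi> r0 \<noteq> 0"
  obtains c \<delta> where "0 < c" "0 < \<delta>" "\<delta> \<le> 1 / 2"
    "\<And>a. r0 + 1 \<le> a \<Longrightarrow> \<exists>\<rho>\<in>{a..a + 1}. \<forall>s. \<bar>s - \<rho>\<bar> \<le> \<delta> \<longrightarrow> c * s powr (- k / 2) \<le> \<bar>\<phi> s\<bar>"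
proof -
  define \<kappa> where "\<kappa> = k / 2 * (k / 2 - 1)"
  define u where "u r = r powr (k / 2) * \<phi> r" for r
  define u' where "u' r = k / 2 * r powr (k / 2 - 1) * \<phi> r + r powr (k / 2) * \<phi>' r" for r
  define E where "E r = (u' r)\<^sup>2 + w\<^sup>2 * (u r)\<^sup>2" for r
  define E' where "E' r = 2 * u' r * u r * \<kappa> / r\<^sup>2" for r
  have du: "(u has_real_derivative u' r) (at r)" if "0 < r" for r
    unfolding u_def u'_def using that
    by (auto intro!: derivative_eq_intros d1)
  have du': "(u' has_real_derivative (\<kappa> / r\<^sup>2 - w\<^sup>2) * u r) (at r)" if r: "0 < r" for r
  proof -
    have p: "r powr (k / 2 - 1) = r powr (k / 2) / r" "r powr (k / 2 - 1 - 1) = r powr (k / 2) / r\<^sup>2"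
      using r by (auto simp: powr_diff power2_eq_square)
    have eq: "\<phi>'' r = - w\<^sup>2 * \<phi> r - k * \<phi>' r / r" using ode[OF r] r by (simp add: field_simps)
    have "k / 2 * ((k / 2 - 1) * r powr (k / 2 - 1 - 1)) * \<phi> r + k / 2 * r powr (k / 2 - 1) * \<phi>' r
        + (k / 2 * r powr (k / 2 - 1) * \<phi>' r + r powr (k / 2) * \<phi>'' r) = (\<kappa> / r\<^sup>2 - w\<^sup>2) * u r"
      using r unfolding eq u_def \<kappa>_def p by (simp add: field_simps power2_eq_square)
    moreover have "(u' has_real_derivative k / 2 * ((k / 2 - 1) * r powr (k / 2 - 1 - 1)) * \<phi> r + k / 2 * r powr (k / 2 - 1) * \<phi>' r
        + (k / 2 * r powr (k / 2 - 1) * \<phi>' r + r powr (k / 2) * \<phi>'' r)) (at r)"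
      unfolding u'_def[abs_def] using r by (auto intro!: derivative_eq_intros d1 d2) (simp add: field_simps)
    ultimately show ?thesis by simp
  qed
  have dE: "(E has_real_derivative E' r) (at r)" if r: "0 < r" for r
    unfolding E_def[abs_def] E'_def using r
    by (auto intro!: derivative_eq_intros du du') (simp add: field_simps power2_eq_square)
  define K where "K = \<bar>\<kappa>\<bar>"
  have E'_le: "\<bar>E' r\<bar> \<le> K / r\<^sup>2 * E r" if r: "0 < r" for r
  proof -
    have "0 \<le> (u' r - u r)\<^sup>2" "0 \<le> (u' r + u r)\<^sup>2" by auto
    then have "\<bar>2 * u' r * u r\<bar> \<le> (u' r)\<^sup>2 + (u r)\<^sup>2"
      by (auto simp: power2_eq_square algebra_simps abs_le_iff)
    also have "\<dots> \<le> E r" using w mult_right_mono[of 1 "w\<^sup>2" "(u r)\<^sup>2"] by (auto simp: E_def)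
    finally have "K / r\<^sup>2 * \<bar>2 * u' r * u r\<bar> \<le> K / r\<^sup>2 * E r"
      by (rule mult_left_mono) (simp add: K_def)
    then show ?thesis by (simp add: E'_def K_def abs_mult abs_divide mult_ac)
  qed
  have u0: "u r0 \<noteq> 0" using r0 by (simp add: u_def)
  have "0 < w\<^sup>2 * (u r0)\<^sup>2" using u0 w by simp
  then have E0: "0 < E r0" unfolding E_def by (rule add_nonneg_pos[rotated]) simp
  define e0 where "e0 = E r0 * exp (- K / r0)"
  define e1 where "e1 = E r0 * exp (K / r0)"
  have e0: "0 < e0" using E0 by (simp add: e0_def)
  have E_lower: "e0 \<le> E r" if "r0 \<le> r" for r
  proof -
    \<comment> \<open>Gronwall: \<open>- K / r\<close> is a primitive of
      \<open>K / r\<^sup>2\<close> and stays bounded for \<open>r \<ge> r0\<close>, so the energy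
      can neither decay to 0 nor blow up.\<close>
    have "E r0 * exp (- K / r0) \<le> E r * exp (- K / r)"
    proof (rule DERIV_nonneg_imp_nondecreasing[OF that])
      fix x assume "r0 \<le> x"
      then have x: "0 < x" using r0 by simp
      have "((\<lambda>r. E r * exp (- K / r)) has_real_derivative (E' x + K / x\<^sup>2 * E x) * exp (- K / x)) (at x)"
        using x by (auto intro!: derivative_eq_intros dE) (simp add: field_simps power2_eq_square)
      moreover have "0 \<le> (E' x + K / x\<^sup>2 * E x) * exp (- K / x)"
        using E'_le[OF x] by simp
      ultimately show "\<exists>y. ((\<lambda>r. E r * exp (- K / r)) has_real_derivative y) (at x) \<and> 0 \<le> y" by blast
    qed
    also have "\<dots> \<le> E r * 1"
      using that r0 by (intro mult_left_mono) (auto simp: K_def E_def)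
    finally show ?thesis by (simp add: e0_def)
  qed
  have E_upper: "E r \<le> e1" if "r0 \<le> r" for r
  proof -
    have "E r * 1 \<le> E r * exp (K / r)"
      using that r0 by (intro mult_left_mono) (auto simp: K_def E_def)
    also have "\<dots> \<le> E r0 * exp (K / r0)"
    proof (rule DERIV_nonpos_imp_nonincreasing[OF that])
      fix x assume "r0 \<le> x"
      then have x: "0 < x" using r0 by simp
      have "((\<lambda>r. E r * exp (K / r)) has_real_derivative (E' x - K / x\<^sup>2 * E x) * exp (K / x)) (at x)"
        using x by (auto intro!: derivative_eq_intros dE) (simp add: field_simps power2_eq_square)
      moreover have "(E' x - K / x\<^sup>2 * E x) * exp (K / x) \<le> 0"
        using E'_le[OF x] by (simp add: mult_le_0_iff)
      ultimately show "\<exists>y. ((\<lambda>r. E r * exp (K / r)) has_real_derivative y) (at x) \<and> y \<le> 0" by blast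
    qed
    finally show ?thesis by (simp add: e1_def)
  qed
  define B where "B = sqrt e1"
  have B: "0 \<le> B" "\<bar>u' r\<bar> \<le> B" if "r0 \<le> r" for r
  proof -
    have "(u' r)\<^sup>2 \<le> E r" by (simp add: E_def)
    then have "(u' r)\<^sup>2 \<le> e1" using E_upper[OF that] by linarith
    then show "\<bar>u' r\<bar> \<le> B" by (simp add: B_def real_le_rsqrt real_sqrt_le_iff abs_le_square_iff flip: real_sqrt_abs)
    then show "0 \<le> B" by linarith
  qed
  \<comment> \<open>Tuned so that \<open>\<bar>u'\<bar> < 4 * c\<close> and
    \<open>\<bar>u\<bar> \<le> 2 * c\<close> at one point would push the energy below its lower
    bound \<open>e0\<close>.\<close>
  define c where "c = sqrt (e0 / (16 + 4 * w\<^sup>2))"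
  have w16: "0 < 16 + 4 * w\<^sup>2" by (simp add: add_pos_nonneg)
  have c: "0 < c" "(4 * c)\<^sup>2 + w\<^sup>2 * (2 * c)\<^sup>2 = e0"
  proof -
    show "0 < c" using e0 w16 by (simp add: c_def)
    have "(16 + 4 * w\<^sup>2) * c\<^sup>2 = e0" using e0 w16 by (simp add: c_def)
    then show "(4 * c)\<^sup>2 + w\<^sup>2 * (2 * c)\<^sup>2 = e0" by (simp add: power_mult_distrib algebra_simps)
  qed
  \<comment> \<open>\<open>u\<close> is \<open>B\<close>-Lipschitz beyond \<open>r0\<close>, so
    within \<open>\<delta>\<close> of \<open>\<rho>\<close> it falls from \<open>2 * c\<close> to
    \<open>c\<close> at worst. \<open>B + 1\<close> covers \<open>B = 0\<close>; the cap
    \<open>1 / 2\<close> keeps \<open>s\<close> beyond \<open>r0\<close> and later keeps balls of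
    this radius disjoint.\<close>
  define \<delta> where "\<delta> = min (1 / 2) (c / (B + 1))"
  have B0: "0 \<le> B" using B(1)[of r0] by simp
  have \<delta>: "0 < \<delta>" "\<delta> \<le> 1 / 2" "B * \<delta> \<le> c"
  proof -
    show "0 < \<delta>" using c B0 by (simp add: \<delta>_def)
    show "\<delta> \<le> 1 / 2" unfolding \<delta>_def by (rule min.cobounded1)
    have "B * \<delta> \<le> B * (c / (B + 1))" using B0 by (intro mult_left_mono) (auto simp: \<delta>_def)
    also have "\<dots> \<le> c" using B0 c by (simp add: field_simps)
    finally show "B * \<delta> \<le> c" .
  qed
  show ?thesis
  proof (rule that[OF c(1) \<delta>(1,2)])
    fix a assume a: "r0 + 1 \<le> a"
    have "\<exists>\<rho>\<in>{a..a + 1}. 2 * c \<le> \<bar>u \<rho>\<bar>"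
    proof (rule ccontr)
      assume "\<not> ?thesis"
      then have small: "\<bar>u r\<bar> < 2 * c" if "a \<le> r" "r \<le> a + 1" for r using that by force
      obtain z where z: "a < z" "z < a + 1" "u (a + 1) - u a = (a + 1 - a) * u' z"
        using MVT2[of a "a + 1" u u'] du a r0 by auto
      then have "\<bar>u' z\<bar> < 4 * c" using small[of a] small[of "a + 1"] by simp
      then have "(u' z)\<^sup>2 < (4 * c)\<^sup>2" using c by (metis abs_ge_zero power2_abs power_strict_mono zero_less_numeral)
      moreover have "(u z)\<^sup>2 \<le> (2 * c)\<^sup>2"
        using small[of z] z by (metis abs_ge_zero less_imp_le power2_abs power_mono)
      then have "w\<^sup>2 * (u z)\<^sup>2 \<le> w\<^sup>2 * (2 * c)\<^sup>2" by (intro mult_left_mono) auto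
      ultimately have "E z < e0" unfolding E_def c(2)[symmetric] by linarith
      then show False using E_lower[of z] z a by simp
    qed
    then obtain \<rho> where \<rho>: "\<rho> \<in> {a..a + 1}" "2 * c \<le> \<bar>u \<rho>\<bar>" by blast
    have "c * s powr (- k / 2) \<le> \<bar>\<phi> s\<bar>" if s: "\<bar>s - \<rho>\<bar> \<le> \<delta>" for s
    proof -
      have pos: "r0 \<le> s" "r0 \<le> \<rho>" using s \<rho> a \<delta> by auto
      have "\<bar>u s - u \<rho>\<bar> \<le> B * \<bar>s - \<rho>\<bar>"
      proof -
        have "norm (u s - u \<rho>) \<le> B * norm (s - \<rho>)"
          using pos r0 B by (intro field_differentiable_bound[of "{r0..}" u u']) 
            (auto intro!: DERIV_subset[OF du])
        then show ?thesis by simp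
      qed
      also have "\<dots> \<le> B * \<delta>" using s B0 by (intro mult_left_mono)
      finally have "c \<le> \<bar>u s\<bar>" using \<rho> \<delta> by linarith
      also have "\<dots> = s powr (k / 2) * \<bar>\<phi> s\<bar>" by (simp add: u_def abs_mult)
      finally have "c * s powr (- k / 2) \<le> (s powr (k / 2) * \<bar>\<phi> s\<bar>) * s powr (- k / 2)"
        by (intro mult_right_mono) auto
      also have "\<dots> = \<bar>\<phi> s\<bar>" using pos r0 by (simp add: powr_minus field_simps)
      finally show ?thesis .
    qed
    then show "\<exists>\<rho>\<in>{a..a + 1}. \<forall>s. \<bar>s - \<rho>\<bar> \<le> \<delta> \<longrightarrow> c * s powr (- k / 2) \<le> \<bar>\<phi> s\<bar>"
      using \<rho> by blast
  qed
qed

text \<open>Dominated convergence for the difference quotients, which the mean value theorem bounds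
  by \<open>B\<close>. The bound is asked only almost everywhere because the integrands to come are
  bounded on the sphere but not on the whole space.\<close>

lemma has_real_derivative_integral_bounded:
  fixes f f' :: "real \<Rightarrow> 'a \<Rightarrow> real"
  assumes "finite_measure M"
    and f: "\<And>t. integrable M (f t)" and f': "\<And>t. f' t \<in> borel_measurable M"
    and deriv: "\<And>t x. x \<in> space M \<Longrightarrow> ((\<lambda>t. f t x) has_real_derivative f' t x) (at t)"
    and bound: "AE x in M. \<forall>t. \<bar>f' t x\<bar> \<le> B"
  shows "((\<lambda>t. \<integral>x. f t x \<partial>M) has_real_derivative (\<integral>x. f' t x \<partial>M)) (at t)"
proof -
  interpret finite_measure M by fact
  have "((\<lambda>h. ((\<integral>x. f (t + h) x \<partial>M) - (\<integral>x. f t x \<partial>M)) / h) \<longlongrightarrow> (\<integral>x. f' t x \<partial>M)) (at 0)"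
    unfolding tendsto_at_iff_sequentially comp_def
  proof (intro allI impI)
    fix X :: "nat \<Rightarrow> real" assume X: "\<forall>i. X i \<in> UNIV - {0}" "X \<longlonglongrightarrow> 0"
    have "(\<lambda>i. \<integral>x. (f (t + X i) x - f t x) / X i \<partial>M) \<longlonglongrightarrow> (\<integral>x. f' t x \<partial>M)"
    proof (rule integral_dominated_convergence[where w = "\<lambda>_. B"])
      show "AE x in M. (\<lambda>i. (f (t + X i) x - f t x) / X i) \<longlonglongrightarrow> f' t x"
      proof (intro AE_I2)
        fix x assume "x \<in> space M"
        then have "((\<lambda>h. (f (t + h) x - f t x) / h) \<longlongrightarrow> f' t x) (at 0)"
          using deriv[of x t] by (simp add: DERIV_def)
        then show "(\<lambda>i. (f (t + X i) x - f t x) / X i) \<longlonglongrightarrow> f' t x"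
          using X unfolding tendsto_at_iff_sequentially comp_def by blast
      qed
      show "AE x in M. norm ((f (t + X i) x - f t x) / X i) \<le> B" for i
        using bound AE_space
      proof eventually_elim
        case (elim x)
        have "norm (f (t + X i) x - f t x) \<le> B * norm (t + X i - t)"
          using elim deriv[of x] by (intro field_differentiable_bound[of UNIV "\<lambda>t. f t x" "\<lambda>t. f' t x"]) auto
        then show ?case using X by (simp add: pos_divide_le_eq)
      qed
    qed (use f f' in \<open>auto intro!: borel_measurable_diff borel_measurable_divide\<close>)
    then show "(\<lambda>i. ((\<integral>x. f (t + X i) x \<partial>M) - (\<integral>x. f t x \<partial>M)) / X i) \<longlonglongrightarrow> (\<integral>x. f' t x \<partial>M)"
      using f by simp
  qed
  then show ?thesis by (simp add: DERIV_def)
qed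

section \<open>The cosine transform of a rotation invariant measure\<close>

text \<open>The Householder reflection in the hyperplane orthogonal to \<open>v\<close>. For
  \<open>v = 0\<close> it is the identity, so \<open>reflection (a - b)\<close> makes sense for
  \<open>a = b\<close> too.\<close>

definition reflection :: "'a::euclidean_space \<Rightarrow> 'a \<Rightarrow> 'a" where
  "reflection v x = x - (2 * (x \<bullet> v) / (v \<bullet> v)) *\<^sub>R v"

lemma reflection_involutive [simp]: "reflection v (reflection v x) = x"
  by (cases "v = 0") (auto simp: reflection_def inner_diff_left diff_divide_distrib simp flip: scaleR_add_left)

lemma reflection_inner: "reflection v x \<bullet> y = x \<bullet> reflection v y"
  by (simp add: reflection_def inner_diff_left inner_diff_right inner_commute)

lemma norm_reflection [simp]: "norm (reflection v x) = norm x"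
  by (simp add: norm_eq_sqrt_inner reflection_inner)

lemma reflection_diff: "reflection v (x - y) = reflection v x - reflection v y"
  by (simp add: reflection_def inner_diff_left diff_divide_distrib algebra_simps)

lemma dist_reflection [simp]: "dist (reflection v x) (reflection v y) = dist x y"
  by (simp add: dist_norm flip: reflection_diff)

text \<open>Equal norms give \<open>2 * (a \<bullet> (a - b)) = (a - b) \<bullet> (a - b)\<close>.
  This replaces the transitivity of the rotation group on spheres.\<close>

lemma reflection_swap:
  assumes "norm a = norm b"
  shows "reflection (a - b) a = b"
proof -
  have "a \<bullet> a = b \<bullet> b" using assms by (simp add: norm_eq_sqrt_inner)
  then have "2 * (a \<bullet> (a - b)) = (a - b) \<bullet> (a - b)"
    by (simp add: inner_diff_left inner_diff_right inner_commute)
  then show ?thesis by (cases "a = b") (auto simp: reflection_def)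
qed

lemma borel_measurable_reflection [measurable]: "reflection v \<in> borel_measurable borel"
proof (cases "v = 0")
  case True
  then show ?thesis by (simp add: reflection_def[abs_def])
next
  case False
  then show ?thesis
    unfolding reflection_def[abs_def] by (intro borel_measurable_continuous_onI continuous_intros) auto
qed

definition coord_proj :: "'n::finite set \<Rightarrow> real^'n \<Rightarrow> real^'n" where
  "coord_proj I x = (\<chi> i. if i \<in> I then x $ i else 0)"

lemma coord_proj_nth [simp]: "coord_proj I x $ i = (if i \<in> I then x $ i else 0)"
  by (simp add: coord_proj_def)

lemma coord_proj_add: "coord_proj I (x + y) = coord_proj I x + coord_proj I y"
  and coord_proj_diff: "coord_proj I (x - y) = coord_proj I x - coord_proj I y"
  and coord_proj_scaleR: "coord_proj I (c *\<^sub>R x) = c *\<^sub>R coord_proj I x"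
  and coord_proj_idem: "coord_proj I (coord_proj I x) = coord_proj I x"
  by (simp_all add: vec_eq_iff)

lemma norm_coord_proj_le: "norm (coord_proj I x) \<le> norm x"
  by (rule norm_le_componentwise_cart) simp

text \<open>Collects what the Fourier part uses of the surface measure, so that Hausdorff measure no
  longer appears there. Invariance is asked for mirrors whose normal lies in the coordinate
  subspace, as these preserve the sphere.\<close>

locale spherical_measure = finite_measure M for M :: "(real^'n::finite) measure" +
  fixes I :: "'n set"
  assumes sets_M: "sets M = sets borel"
    and nonzero: "emeasure M (space M) \<noteq> 0"
    and on_sphere: "AE x in M. x \<in> coord_sphere I"
    and reflect: "\<And>v. (\<forall>i. i \<notin> I \<longrightarrow> v $ i = 0) \<Longrightarrow> distr M M (reflection v) = M"
begin

lemma space_M [simp]: "space M = UNIV"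
  using sets_eq_imp_space_eq[OF sets_M] by simp

lemma borel_measurable_M_continuous: "continuous_on UNIV f \<Longrightarrow> (f :: _ \<Rightarrow> real) \<in> borel_measurable M"
  using borel_measurable_continuous_onI measurable_cong_sets[OF sets_M refl] by blast

lemma AE_component_le: "AE x in M. \<forall>i. \<bar>x $ i\<bar> \<le> 1"
  using on_sphere
proof eventually_elim
  case (elim x)
  then show ?case using component_le_norm_cart[of x] by (simp add: coord_sphere_def)
qed

text \<open>The real part of the Fourier transform; a lower bound for it is one for the modulus of
  the transform.\<close>

definition osc :: "real^'n \<Rightarrow> real" where
  "osc \<xi> = (\<integral>x. cos (2 * pi * (x \<bullet> \<xi>)) \<partial>M)"

lemma integrable_bounded_continuous:
  assumes "continuous_on UNIV f" "AE x in M. \<bar>f x\<bar> \<le> B"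
  shows "integrable M (f :: _ \<Rightarrow> real)"
  using assms by (intro integrable_const_bound[of _ B] borel_measurable_M_continuous) auto

text \<open>Invariance allows the substitution of the reflection that swaps \<open>a\<close> and
  \<open>b\<close>; self-adjointness moves it from \<open>x\<close> to the frequency.\<close>

lemma osc_reflection:
  assumes "\<And>i. i \<notin> I \<Longrightarrow> a $ i = 0" "\<And>i. i \<notin> I \<Longrightarrow> b $ i = 0" "norm a = norm b"
  shows "osc a = osc b"
proof -
  have "osc a = (\<integral>x. cos (2 * pi * (x \<bullet> a)) \<partial>distr M M (reflection (a - b)))"
    using assms by (simp add: reflect osc_def)
  also have "\<dots> = (\<integral>x. cos (2 * pi * (reflection (a - b) x \<bullet> a)) \<partial>M)"
    by (intro integral_distr borel_measurable_M_continuous continuous_intros)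
      (simp add: cong: measurable_cong_sets[OF sets_M sets_M])
  also have "\<dots> = osc b"
    using assms by (simp add: osc_def reflection_inner reflection_swap)
  finally show ?thesis .
qed

lemma osc_coord_proj: "osc (coord_proj I \<xi>) = osc \<xi>"
  unfolding osc_def
proof (rule integral_cong_AE)
  show "AE x in M. cos (2 * pi * (x \<bullet> coord_proj I \<xi>)) = cos (2 * pi * (x \<bullet> \<xi>))"
    using on_sphere
  proof eventually_elim
    case (elim x)
    then have "x \<bullet> coord_proj I \<xi> = x \<bullet> \<xi>"
      unfolding inner_vec_def by (intro sum.cong) (auto simp: coord_sphere_def)
    then show ?case by simp
  qed
qed (intro borel_measurable_M_continuous continuous_intros)+

lemma osc_eq_norm_coord_proj:
  assumes "i \<in> I"
  shows "osc \<xi> = osc (norm (coord_proj I \<xi>) *\<^sub>R axis i 1)"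
proof -
  have "l \<notin> I \<Longrightarrow> axis i (1::real) $ l = 0" for l using assms by (auto simp: axis_def)
  then have "osc (coord_proj I \<xi>) = osc (norm (coord_proj I \<xi>) *\<^sub>R axis i 1)"
    by (intro osc_reflection) auto
  then show ?thesis by (simp add: osc_coord_proj)
qed

context
  fixes i assumes i: "i \<in> I"
begin

text \<open>\<open>osc\<close> along the axis \<open>i\<close>, followed by the integrals that
  formal differentiation in \<open>r\<close> produces.\<close>

definition "prof r = (\<integral>x. cos (2 * pi * r * x $ i) \<partial>M)"
definition "prof' r = (\<integral>x. - (2 * pi * x $ i) * sin (2 * pi * r * x $ i) \<partial>M)"
definition "prof'' r = (\<integral>x. - (2 * pi * x $ i)\<^sup>2 * cos (2 * pi * r * x $ i) \<partial>M)"

lemma osc_eq_prof: "osc \<xi> = prof (norm (coord_proj I \<xi>))"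
  unfolding osc_eq_norm_coord_proj[OF i, of \<xi>] by (simp add: osc_def prof_def inner_axis mult_ac)

lemma prof_deriv: "(prof has_real_derivative prof' r) (at r)"
  unfolding prof_def[abs_def] prof'_def
proof (rule has_real_derivative_integral_bounded)
  show "AE x in M. \<forall>t. \<bar>- (2 * pi * x $ i) * sin (2 * pi * t * x $ i)\<bar> \<le> 2 * pi"
    using AE_component_le
  proof eventually_elim
    case (elim x)
    then have "\<bar>x $ i\<bar> * \<bar>sin (2 * pi * t * x $ i)\<bar> \<le> 1 * 1" for t by (intro mult_mono) auto
    then show ?case by (simp add: abs_mult)
  qed
  show "integrable M (\<lambda>x. cos (2 * pi * t * x $ i))" for t
    by (rule integrable_bounded_continuous[of _ 1]) (auto intro!: continuous_intros)
qed (auto intro!: derivative_eq_intros borel_measurable_M_continuous continuous_intros finite_measure_axioms)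

lemma prof'_deriv: "(prof' has_real_derivative prof'' r) (at r)"
  unfolding prof'_def[abs_def] prof''_def
proof (rule has_real_derivative_integral_bounded)
  show "AE x in M. \<forall>t. \<bar>- (2 * pi * x $ i)\<^sup>2 * cos (2 * pi * t * x $ i)\<bar> \<le> (2 * pi)\<^sup>2"
    using AE_component_le
  proof eventually_elim
    case (elim x)
    then have "(x $ i)\<^sup>2 * \<bar>cos (2 * pi * t * x $ i)\<bar> \<le> 1 * 1" for t
      by (intro mult_mono) (auto simp: abs_square_le_1)
    then show ?case by (simp add: abs_mult power_mult_distrib)
  qed
  show "integrable M (\<lambda>x. - (2 * pi * x $ i) * sin (2 * pi * t * x $ i))" for t
  proof (rule integrable_bounded_continuous[of _ "2 * pi"])
    show "AE x in M. \<bar>- (2 * pi * x $ i) * sin (2 * pi * t * x $ i)\<bar> \<le> 2 * pi"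
      using AE_component_le
    proof eventually_elim
      case (elim x)
      then have "\<bar>x $ i\<bar> * \<bar>sin (2 * pi * t * x $ i)\<bar> \<le> 1 * 1" by (intro mult_mono) auto
      then show ?case by (simp add: abs_mult)
    qed
  qed (auto intro!: continuous_intros)
qed (auto intro!: derivative_eq_intros borel_measurable_M_continuous continuous_intros finite_measure_axioms
    simp: power2_eq_square)

text \<open>The function \<open>\<theta> \<mapsto> osc (r cos \<theta> e\<^sub>i + r sin \<theta> e\<^sub>j)\<close> is constant;
  this is its second derivative at \<open>0\<close>.\<close>
lemma rotation_identity:
  assumes j: "j \<in> I" "j \<noteq> i"
  shows "(\<integral>x. (2 * pi * r * x $ j)\<^sup>2 * cos (2 * pi * r * x $ i) \<partial>M)
    = (\<integral>x. 2 * pi * r * x $ i * sin (2 * pi * r * x $ i) \<partial>M)"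
proof -
  define w where "w = 2 * pi * r"
  \<comment> \<open>\<open>a t x\<close> is the phase for the frequency turned by the angle
    \<open>t\<close> in the \<open>i\<close>-\<open>j\<close> plane; \<open>b\<close> is its
    derivative in \<open>t\<close>, and the derivative of \<open>b\<close> is
    \<open>- a\<close>.\<close>
  define a where "a t x = w * (cos t * x $ i + sin t * x $ j)" for t and x :: "real^'n"
  define b where "b t x = w * (cos t * x $ j - sin t * x $ i)" for t and x :: "real^'n"
  have da: "((\<lambda>t. a t x) has_real_derivative b t x) (at t)" for t x
    unfolding a_def b_def by (auto intro!: derivative_eq_intros)
  have db: "((\<lambda>t. b t x) has_real_derivative - a t x) (at t)" for t x
    unfolding a_def b_def by (auto intro!: derivative_eq_intros simp: algebra_simps)
  have cont: "continuous_on UNIV (a t)" "continuous_on UNIV (b t)" for t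
    unfolding a_def b_def by (auto intro!: continuous_intros)
  have bounds: "AE x in M. \<forall>t. \<bar>a t x\<bar> \<le> 2 * \<bar>w\<bar> \<and> \<bar>b t x\<bar> \<le> 2 * \<bar>w\<bar>"
    using AE_component_le
  proof eventually_elim
    case (elim x)
    show ?case
    proof
      fix t
      have le: "\<bar>c * x $ l\<bar> \<le> 1" if "\<bar>c\<bar> \<le> 1" for c l
        using elim that mult_mono[of "\<bar>c\<bar>" 1 "\<bar>x $ l\<bar>" 1] by (auto simp: abs_mult)
      have "\<bar>cos t * x $ i + sin t * x $ j\<bar> \<le> 2" "\<bar>cos t * x $ j - sin t * x $ i\<bar> \<le> 2"
        using le[of "cos t" i] le[of "sin t" j] le[of "cos t" j] le[of "sin t" i] by auto
      then show "\<bar>a t x\<bar> \<le> 2 * \<bar>w\<bar> \<and> \<bar>b t x\<bar> \<le> 2 * \<bar>w\<bar>"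
        unfolding a_def b_def abs_mult mult.commute[of 2] by (auto intro!: mult_left_mono)
    qed
  qed
  have const: "(\<integral>x. cos (a t x) \<partial>M) = prof r" for t
  proof -
    define v where "v = (r * cos t) *\<^sub>R axis i 1 + (r * sin t) *\<^sub>R axis j (1::real)"
    have "v \<bullet> v = (r * cos t)\<^sup>2 + (r * sin t)\<^sup>2"
      using j by (simp add: v_def inner_add_left inner_add_right inner_axis_axis power2_eq_square)
    also have "\<dots> = r\<^sup>2 * ((cos t)\<^sup>2 + (sin t)\<^sup>2)"
      by (simp only: power_mult_distrib distrib_left)
    finally have "v \<bullet> v = r\<^sup>2" by simp
    then have "v \<bullet> v = (r *\<^sub>R axis i 1) \<bullet> (r *\<^sub>R axis i (1::real))"
      by (simp add: inner_axis_axis power2_eq_square)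
    then have "norm v = norm (r *\<^sub>R axis i (1::real) :: real^'n)" by (simp only: norm_eq_sqrt_inner)
    then have "osc v = osc (r *\<^sub>R axis i 1)"
      using i j by (intro osc_reflection) (auto simp: v_def axis_def)
    moreover have "osc v = (\<integral>x. cos (a t x) \<partial>M)"
      by (simp add: osc_def v_def a_def w_def inner_add_right inner_axis algebra_simps)
    moreover have "osc (r *\<^sub>R axis i 1) = prof r"
      by (simp add: osc_def prof_def inner_axis mult_ac)
    ultimately show ?thesis by simp
  qed
  have bound1: "AE x in M. \<forall>t. \<bar>- sin (a t x) * b t x\<bar> \<le> 2 * \<bar>w\<bar>"
    using bounds
  proof eventually_elim
    case (elim x)
    then have "\<bar>sin (a t x)\<bar> * \<bar>b t x\<bar> \<le> 1 * (2 * \<bar>w\<bar>)" for t by (intro mult_mono) auto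
    then show ?case by (simp add: abs_mult)
  qed
  \<comment> \<open>The integral of \<open>cos (a t x)\<close> is constant in \<open>t\<close>, so
    its derivative vanishes at every \<open>t\<close> and may be differentiated once more at
    0.\<close>
  have first: "(\<integral>x. - sin (a t x) * b t x \<partial>M) = 0" for t
  proof -
    have "((\<lambda>t. \<integral>x. cos (a t x) \<partial>M) has_real_derivative (\<integral>x. - sin (a t x) * b t x \<partial>M)) (at t)"
      by (rule has_real_derivative_integral_bounded[OF finite_measure_axioms _ _ _ bound1])
        (auto intro!: derivative_eq_intros da borel_measurable_M_continuous continuous_intros cont
          integrable_bounded_continuous[of _ 1])
    from DERIV_unique[OF this[unfolded const] DERIV_const] show ?thesis .
  qed
  have bound2: "AE x in M. \<forall>t. \<bar>- cos (a t x) * (b t x)\<^sup>2 + sin (a t x) * a t x\<bar> \<le> (2 * \<bar>w\<bar>)\<^sup>2 + 2 * \<bar>w\<bar>"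
    using bounds
  proof eventually_elim
    case (elim x)
    show ?case
    proof
      fix t
      have "(b t x)\<^sup>2 \<le> (2 * \<bar>w\<bar>)\<^sup>2" using elim by (metis abs_ge_zero power2_abs power_mono)
      then have "\<bar>cos (a t x)\<bar> * (b t x)\<^sup>2 \<le> 1 * (2 * \<bar>w\<bar>)\<^sup>2" by (intro mult_mono) auto
      moreover have "\<bar>sin (a t x)\<bar> * \<bar>a t x\<bar> \<le> 1 * (2 * \<bar>w\<bar>)" using elim by (intro mult_mono) auto
      moreover have "\<bar>- cos (a t x) * (b t x)\<^sup>2 + sin (a t x) * a t x\<bar>
          \<le> \<bar>cos (a t x)\<bar> * (b t x)\<^sup>2 + \<bar>sin (a t x)\<bar> * \<bar>a t x\<bar>"
        by (rule order_trans[OF abs_triangle_ineq]) (simp add: abs_mult)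
      ultimately show "\<bar>- cos (a t x) * (b t x)\<^sup>2 + sin (a t x) * a t x\<bar> \<le> (2 * \<bar>w\<bar>)\<^sup>2 + 2 * \<bar>w\<bar>"
        by linarith
    qed
  qed
  have int1: "integrable M (\<lambda>x. - sin (a t x) * b t x)" for t
  proof (rule integrable_bounded_continuous)
    show "AE x in M. \<bar>- sin (a t x) * b t x\<bar> \<le> 2 * \<bar>w\<bar>" using bound1 by eventually_elim blast
  qed (auto intro!: continuous_intros cont)
  have "((\<lambda>t. \<integral>x. - sin (a t x) * b t x \<partial>M) has_real_derivative
      (\<integral>x. - cos (a 0 x) * (b 0 x)\<^sup>2 + sin (a 0 x) * a 0 x \<partial>M)) (at 0)"
    by (rule has_real_derivative_integral_bounded[OF finite_measure_axioms int1 _ _ bound2])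
      (auto intro!: derivative_eq_intros da db borel_measurable_M_continuous continuous_intros cont
        simp: power2_eq_square)
  from DERIV_unique[OF this[unfolded first] DERIV_const]
  have "(\<integral>x. - cos (a 0 x) * (b 0 x)\<^sup>2 + sin (a 0 x) * a 0 x \<partial>M) = 0" .
  moreover have "integrable M (\<lambda>x. (w * x $ j)\<^sup>2 * cos (w * x $ i))"
  proof (rule integrable_bounded_continuous)
    show "AE x in M. \<bar>(w * x $ j)\<^sup>2 * cos (w * x $ i)\<bar> \<le> w\<^sup>2"
      using AE_component_le
    proof eventually_elim
      case (elim x)
      then have "(x $ j)\<^sup>2 * \<bar>cos (w * x $ i)\<bar> \<le> 1 * 1" by (intro mult_mono) (auto simp: abs_square_le_1)
      then show ?case using mult_left_mono[of _ 1 "w\<^sup>2"] by (simp add: abs_mult power_mult_distrib mult.assoc)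
    qed
  qed (auto intro!: continuous_intros)
  moreover have "integrable M (\<lambda>x. w * x $ i * sin (w * x $ i))"
  proof (rule integrable_bounded_continuous)
    show "AE x in M. \<bar>w * x $ i * sin (w * x $ i)\<bar> \<le> \<bar>w\<bar>"
      using AE_component_le
    proof eventually_elim
      case (elim x)
      then have "\<bar>x $ i\<bar> * \<bar>sin (w * x $ i)\<bar> \<le> 1 * 1" by (intro mult_mono) auto
      then show ?case using mult_left_mono[of _ 1 "\<bar>w\<bar>"] by (simp add: abs_mult mult.assoc)
    qed
  qed (auto intro!: continuous_intros)
  moreover have "- cos (a 0 x) * (b 0 x)\<^sup>2 + sin (a 0 x) * a 0 x
      = w * x $ i * sin (w * x $ i) - (w * x $ j)\<^sup>2 * cos (w * x $ i)" for x
    by (simp add: a_def b_def)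
  ultimately have "(\<integral>x. w * x $ i * sin (w * x $ i) \<partial>M) - (\<integral>x. (w * x $ j)\<^sup>2 * cos (w * x $ i) \<partial>M) = 0"
    by (simp only: Bochner_Integration.integral_diff)
  then show ?thesis unfolding w_def by simp
qed

text \<open>The radial Helmholtz equation in dimension \<open>card I\<close>. Summing
  \<open>rotation_identity\<close> over the \<open>j \<noteq> i\<close> in \<open>I\<close> puts
  \<open>1 - (x $ i)\<^sup>2\<close> under the integral, which gives back \<open>prof\<close> and
  \<open>prof''\<close>; a common factor \<open>r\<close> is cancelled at the end.\<close>

lemma prof_ode:
  assumes r: "0 < r"
  shows "r * (prof'' r + (2 * pi)\<^sup>2 * prof r) + (real (card I) - 1) * prof' r = 0"
proof -
  define w where "w = 2 * pi * r"
  let ?J = "I - {i}"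
  have cardJ: "real (card ?J) = real (card I) - 1"
  proof -
    have "1 \<le> card I" using i by (auto simp: Suc_le_eq card_gt_0_iff)
    then show ?thesis using i by (simp add: card_Diff_singleton of_nat_diff)
  qed
  have int: "integrable M (\<lambda>x. (w * x $ l)\<^sup>2 * cos (w * x $ i))" for l
  proof (rule integrable_bounded_continuous)
    show "AE x in M. \<bar>(w * x $ l)\<^sup>2 * cos (w * x $ i)\<bar> \<le> w\<^sup>2"
      using AE_component_le
    proof eventually_elim
      case (elim x)
      then have "(x $ l)\<^sup>2 * \<bar>cos (w * x $ i)\<bar> \<le> 1 * 1" by (intro mult_mono) (auto simp: abs_square_le_1)
      then show ?case using mult_left_mono[of _ 1 "w\<^sup>2"] by (simp add: abs_mult power_mult_distrib mult.assoc)
    qed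
  qed (auto intro!: continuous_intros)
  have int_cos: "integrable M (\<lambda>x. w\<^sup>2 * cos (w * x $ i))"
    by (rule integrable_bounded_continuous[of _ "w\<^sup>2"])
      (auto intro!: continuous_intros simp: abs_mult mult_left_le)
  have "(\<Sum>j\<in>?J. \<integral>x. (w * x $ j)\<^sup>2 * cos (w * x $ i) \<partial>M) = (\<integral>x. (\<Sum>j\<in>?J. (w * x $ j)\<^sup>2 * cos (w * x $ i)) \<partial>M)"
    using int by (simp add: Bochner_Integration.integral_sum)
  also have "\<dots> = (\<integral>x. w\<^sup>2 * cos (w * x $ i) - (w * x $ i)\<^sup>2 * cos (w * x $ i) \<partial>M)"
  proof (rule integral_cong_AE)
    show "AE x in M. (\<Sum>j\<in>?J. (w * x $ j)\<^sup>2 * cos (w * x $ i))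
        = w\<^sup>2 * cos (w * x $ i) - (w * x $ i)\<^sup>2 * cos (w * x $ i)"
      using on_sphere
    proof eventually_elim
      case (elim x)
      then have "(\<Sum>j\<in>?J. (x $ j)\<^sup>2) = 1 - (x $ i)\<^sup>2"
        using sum_squares_coord_subspace[of I x] i by (simp add: coord_sphere_def sum_diff1)
      then have "(\<Sum>j\<in>?J. (w * x $ j)\<^sup>2 * cos (w * x $ i)) = w\<^sup>2 * (1 - (x $ i)\<^sup>2) * cos (w * x $ i)"
        by (simp add: power_mult_distrib flip: sum_distrib_left sum_distrib_right)
      then show ?case by (simp add: algebra_simps)
    qed
  qed (intro borel_measurable_M_continuous continuous_intros)+
  also have "\<dots> = w\<^sup>2 * prof r + r\<^sup>2 * prof'' r"
  proof -
    have "(\<integral>x. (w * x $ i)\<^sup>2 * cos (w * x $ i) \<partial>M) = (\<integral>x. (- r\<^sup>2) * (- (2 * pi * x $ i)\<^sup>2 * cos (2 * pi * r * x $ i)) \<partial>M)"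
      by (intro Bochner_Integration.integral_cong) (auto simp: w_def power_mult_distrib mult_ac)
    also have "\<dots> = (- r\<^sup>2) * prof'' r"
      unfolding prof''_def by (rule integral_mult_right_zero)
    finally show ?thesis
      using Bochner_Integration.integral_diff[OF int_cos int[of i]] by (simp add: prof_def w_def)
  qed
  also have "(\<Sum>j\<in>?J. \<integral>x. (w * x $ j)\<^sup>2 * cos (w * x $ i) \<partial>M) = (\<Sum>j\<in>?J. - r * prof' r)"
  proof (rule sum.cong)
    fix j assume j: "j \<in> ?J"
    have "(\<integral>x. w * x $ i * sin (w * x $ i) \<partial>M) = (\<integral>x. (- r) * (- (2 * pi * x $ i) * sin (2 * pi * r * x $ i)) \<partial>M)"
      by (intro Bochner_Integration.integral_cong) (auto simp: w_def mult_ac)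
    also have "\<dots> = (- r) * prof' r"
      unfolding prof'_def by (rule integral_mult_right_zero)
    finally show "(\<integral>x. (w * x $ j)\<^sup>2 * cos (w * x $ i) \<partial>M) = - r * prof' r"
      using rotation_identity[of j r] j by (simp add: w_def)
  qed simp
  finally have "r * (r * (prof'' r + (2 * pi)\<^sup>2 * prof r) + (real (card I) - 1) * prof' r) = 0"
    by (simp add: cardJ w_def power2_eq_square algebra_simps)
  then show ?thesis using r by simp
qed

text \<open>The value at 0 is the total mass, and continuity carries it to some
  \<open>r > 0\<close>. With \<open>r \<le> 1\<close>, lattice points at radius at least 4 are far
  enough out for the oscillation bound.\<close>

lemma prof_nonzero: "\<exists>r>0. r \<le> 1 \<and> prof r \<noteq> 0"
proof -
  have "prof 0 \<noteq> 0" using nonzero by (simp add: prof_def measure_eq_0_null_sets emeasure_eq_measure)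
  moreover have "isCont prof 0" using prof_deriv by (rule DERIV_isCont)
  ultimately have "\<forall>\<^sub>F r in at 0. prof r \<noteq> 0"
    by (simp add: isCont_def tendsto_imp_eventually_ne)
  then obtain d where d: "0 < d" "\<And>r. r \<noteq> 0 \<Longrightarrow> dist r 0 < d \<Longrightarrow> prof r \<noteq> 0"
    unfolding eventually_at by auto
  define r where "r = min 1 (d / 2)"
  have "0 < r" "r \<le> 1" "r < d" using d(1) by (auto simp: r_def min_def)
  then show ?thesis using d(2)[of r] by (auto simp: dist_real_def)
qed

end

end

lemma continuous_on_coord_proj: "continuous_on S (coord_proj I)"
  unfolding continuous_on_iff dist_norm coord_proj_diff[symmetric]
  using norm_coord_proj_le le_less_trans by blast

text \<open>Each point of a lattice of mesh \<open>4\<close> is moved radially (within the first coordinates) by at most \<open>1\<close>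
  to a radius where the profile is large; the balls of radius \<open>\<delta>\<close> around the new points stay disjoint.\<close>
lemma (in spherical_measure) osc_large_set:
  assumes I: "I \<noteq> {}"
  obtains A c v :: real and N0 :: nat where "0 < A" "0 < c" "0 < v" "0 < N0"
    "\<And>N. N0 \<le> N \<Longrightarrow> ennreal (v * real N ^ CARD('n)) \<le>
      emeasure lborel {\<xi>. 0 < norm \<xi> \<and> norm \<xi> \<le> A * real N \<and>
        c * real N powr (- (real (card I) - 1) / 2) \<le> \<bar>osc \<xi>\<bar>}"
proof -
  obtain i where i: "i \<in> I" using I by blast
  define k where "k = real (card I) - 1"
  define d where "d = real CARD('n)"
  have k: "0 \<le> k" using i by (auto simp: k_def Suc_le_eq card_gt_0_iff)
  have d: "1 \<le> d" by (simp add: d_def Suc_le_eq)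
  obtain r0 where r0: "0 < r0" "r0 \<le> 1" "prof i r0 \<noteq> 0" using prof_nonzero[OF i] by blast
  have pi2: "1 \<le> 2 * pi" using pi_ge_two by linarith
  obtain c \<delta> where c: "0 < c" "0 < \<delta>" "\<delta> \<le> 1 / 2"
    "\<And>a. r0 + 1 \<le> a \<Longrightarrow>
      \<exists>\<rho>\<in>{a..a + 1}. \<forall>s. \<bar>s - \<rho>\<bar> \<le> \<delta> \<longrightarrow> c * s powr (- k / 2) \<le> \<bar>prof i s\<bar>"
    using oscillation_lower_bound[OF prof_deriv[OF i] prof'_deriv[OF i] prof_ode[OF i] pi2 r0(1,3)]
    unfolding k_def by blast
  \<comment> \<open>A lattice point has norm at most \<open>8 * d * N\<close>; the shift of at most
    1 and the ball radius of at most \<open>1 / 2\<close> fit into another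
    \<open>2 * d * N\<close>.\<close>
  define A where "A = 10 * d"
  have A: "0 < A" using d by (simp add: A_def)
  have meas: "{\<xi>. 0 < norm \<xi> \<and> norm \<xi> \<le> A * real N \<and> c * A powr (- k / 2) * real N powr (- k / 2) \<le> \<bar>osc \<xi>\<bar>}
      \<in> sets lborel" for N :: nat
  proof -
    have "continuous_on UNIV (prof i)"
      by (intro continuous_at_imp_continuous_on ballI DERIV_isCont[OF prof_deriv[OF i]])
    then have "prof i \<in> borel_measurable borel" by (rule borel_measurable_continuous_onI)
    moreover have "(\<lambda>\<xi>. norm (coord_proj I \<xi>)) \<in> borel_measurable borel"
      by (intro borel_measurable_continuous_onI continuous_on_norm continuous_on_coord_proj)
    ultimately have [measurable]: "osc \<in> borel_measurable borel"
      unfolding osc_eq_prof[OF i, abs_def] by (rule measurable_compose[rotated])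
    then show ?thesis by measurable
  qed
  have large: "ennreal (unit_ball_vol d * \<delta> ^ CARD('n) * real N ^ CARD('n))
      \<le> emeasure lborel {\<xi>. 0 < norm \<xi> \<and> norm \<xi> \<le> A * real N \<and>
          c * A powr (- k / 2) * real N powr (- k / 2) \<le> \<bar>osc \<xi>\<bar>}"
    (is "_ \<le> emeasure lborel ?G") if N: "1 \<le> N" for N :: nat
  proof -
    \<comment> \<open>All coordinates are at least \<open>N\<close>, so the projection of each
      lattice point has norm at least \<open>4 * N\<close> and the number of points is still
      \<open>N ^ CARD('n)\<close>.\<close>
    define Z where "Z = PiE (UNIV :: 'n set) (\<lambda>_. {N..<2 * N})"
    have Z: "finite Z" "card Z = N ^ CARD('n)" by (auto simp: Z_def card_PiE intro: finite_PiE)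
    define p :: "('n \<Rightarrow> nat) \<Rightarrow> real^'n" where "p z = (\<chi> j. 4 * real (z j))" for z
    have N4: "4 * real N \<le> norm (coord_proj I (p z))" if "z \<in> Z" for z
    proof -
      have "4 * real N \<le> \<bar>coord_proj I (p z) $ i\<bar>" using that i by (auto simp: Z_def p_def PiE_def Pi_def)
      then show ?thesis using component_le_norm_cart order_trans by blast
    qed
    have "\<exists>\<rho>\<in>{norm (coord_proj I (p z))..norm (coord_proj I (p z)) + 1}.
        \<forall>s. \<bar>s - \<rho>\<bar> \<le> \<delta> \<longrightarrow> c * s powr (- k / 2) \<le> \<bar>prof i s\<bar>" if "z \<in> Z" for z
      using N4[OF that] N r0 by (intro c(4)) linarith
    then have "\<forall>z\<in>Z. \<exists>\<rho>. norm (coord_proj I (p z)) \<le> \<rho> \<and> \<rho> \<le> norm (coord_proj I (p z)) + 1 \<and>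
        (\<forall>s. \<bar>s - \<rho>\<bar> \<le> \<delta> \<longrightarrow> c * s powr (- k / 2) \<le> \<bar>prof i s\<bar>)"
      unfolding Bex_def atLeastAtMost_iff by blast
    from bchoice[OF this] obtain \<rho> where \<rho>: "\<And>z. z \<in> Z \<Longrightarrow> norm (coord_proj I (p z)) \<le> \<rho> z"
      "\<And>z. z \<in> Z \<Longrightarrow> \<rho> z \<le> norm (coord_proj I (p z)) + 1"
      "\<And>z s. z \<in> Z \<Longrightarrow> \<bar>s - \<rho> z\<bar> \<le> \<delta> \<Longrightarrow> c * s powr (- k / 2) \<le> \<bar>prof i s\<bar>"
      by blast
    \<comment> \<open>The projection is rescaled to length \<open>\<rho> z\<close>, and the
      coordinates outside \<open>I\<close> stay as they are.\<close>
    define q where "q z = p z + ((\<rho> z - norm (coord_proj I (p z))) / norm (coord_proj I (p z))) *\<^sub>R coord_proj I (p z)" for z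
    have dist_pq: "dist (p z) (q z) \<le> 1" if "z \<in> Z" for z
      using \<rho>(1,2)[OF that] N4[OF that] N by (simp add: q_def dist_norm)
    have norm_q: "norm (coord_proj I (q z)) = \<rho> z" if "z \<in> Z" for z
    proof -
      have n: "0 < norm (coord_proj I (p z))" using N4[OF that] N by linarith
      then have "coord_proj I (q z) = (\<rho> z / norm (coord_proj I (p z))) *\<^sub>R coord_proj I (p z)"
        unfolding q_def coord_proj_add coord_proj_scaleR coord_proj_idem
        by (simp add: diff_divide_distrib scaleR_diff_left)
      moreover have "0 \<le> \<rho> z" using n \<rho>(1)[OF that] by linarith
      ultimately show ?thesis using n by simp
    qed
    have "ball (q z) \<delta> \<subseteq> ?G" if z: "z \<in> Z" for z
    proof
      fix \<xi> assume \<xi>: "\<xi> \<in> ball (q z) \<delta>"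
      define s where "s = norm (coord_proj I \<xi>)"
      have "\<bar>s - \<rho> z\<bar> \<le> norm (coord_proj I (\<xi> - q z))"
        unfolding s_def norm_q[OF z, symmetric] coord_proj_diff by (rule norm_triangle_ineq3)
      also have "\<dots> \<le> norm (\<xi> - q z)" by (rule norm_coord_proj_le)
      also have "\<dots> < \<delta>" using \<xi> by (simp add: dist_norm norm_minus_commute)
      finally have s: "\<bar>s - \<rho> z\<bar> < \<delta>" .
      have "4 * real N \<le> \<rho> z" using N4[OF z] \<rho>(1)[OF z] by linarith
      then have s_pos: "0 < s" using s c(3) N by linarith
      have "norm (p z) \<le> (\<Sum>j\<in>UNIV. \<bar>p z $ j\<bar>)" by (rule norm_le_l1_cart)
      also have "\<dots> \<le> (\<Sum>j\<in>(UNIV :: 'n set). 8 * real N)"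
      proof (rule sum_mono)
        fix j
        have "z j < 2 * N" using z by (auto simp: Z_def PiE_def Pi_def)
        then show "\<bar>p z $ j\<bar> \<le> 8 * real N" by (simp add: p_def)
      qed
      also have "\<dots> = 8 * (d * real N)" by (simp add: d_def)
      finally have "norm (p z) \<le> 8 * (d * real N)" .
      moreover have "norm \<xi> \<le> norm (p z) + dist (p z) (q z) + dist (q z) \<xi>"
        using norm_triangle_sub[of \<xi> "p z"] dist_triangle[of "p z" \<xi> "q z"]
        by (simp add: dist_norm norm_minus_commute)
      moreover have "1 \<le> d * real N" using d N mult_mono[of 1 d 1 "real N"] by simp
      ultimately have norm_le: "norm \<xi> \<le> A * real N"
        using dist_pq[OF z] \<xi> c(3) by (simp add: A_def)
      have s_le: "s \<le> norm \<xi>" unfolding s_def by (rule norm_coord_proj_le)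
      \<comment> \<open>The exponent is not positive, so the upper bound on \<open>s\<close> turns
        into a lower bound that is uniform over all the balls.\<close>
      have "(A * real N) powr (- k / 2) \<le> s powr (- k / 2)"
        using s_le norm_le s_pos k by (intro powr_mono2') auto
      then have "c * A powr (- k / 2) * real N powr (- k / 2) \<le> c * s powr (- k / 2)"
        using c(1) A by (simp add: powr_mult)
      also have "\<dots> \<le> \<bar>osc \<xi>\<bar>" using \<rho>(3)[OF z, of s] s by (simp add: osc_eq_prof[OF i] s_def)
      finally show "\<xi> \<in> ?G" using norm_le s_pos s_le by auto
    qed
    then have "emeasure lborel (\<Union>z\<in>Z. ball (q z) \<delta>) \<le> emeasure lborel ?G"
      by (intro emeasure_mono meas) blast
    \<comment> \<open>Distinct lattice points differ by at least 4 in some coordinate; two shifts of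
      at most 1 and two radii of at most \<open>1 / 2\<close> make up less than 3.\<close>
    moreover have "disjoint_family_on (\<lambda>z. ball (q z) \<delta>) Z"
    proof (unfold disjoint_family_on_def, intro ballI impI, rule ccontr)
      fix z z' assume z: "z \<in> Z" "z' \<in> Z" "z \<noteq> z'" and "ball (q z) \<delta> \<inter> ball (q z') \<delta> \<noteq> {}"
      then obtain \<xi> where "dist (q z) \<xi> < \<delta>" "dist (q z') \<xi> < \<delta>" by auto
      then have "dist (q z) (q z') < 1" using c(3) dist_triangle2[of "q z" "q z'" \<xi>] by linarith
      then have lt: "dist (p z) (p z') < 4"
        using dist_pq[OF z(1)] dist_pq[OF z(2)] dist_triangle[of "p z" "p z'" "q z"]
          dist_triangle[of "q z" "p z'" "q z'"] by (simp add: dist_commute)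
      obtain j where j: "z j \<noteq> z' j" using z(3) by blast
      then have "4 \<le> \<bar>(p z - p z') $ j\<bar>" by (simp add: p_def)
      then show False using lt component_le_norm_cart[of "p z - p z'" j] by (simp add: dist_norm)
    qed
    then have "emeasure lborel (\<Union>z\<in>Z. ball (q z) \<delta>) = (\<Sum>z\<in>Z. emeasure lborel (ball (q z) \<delta>))"
      using Z(1) by (intro sum_emeasure[symmetric]) auto
    moreover have "(\<Sum>z\<in>Z. emeasure lborel (ball (q z) \<delta>))
        = ennreal (unit_ball_vol d * \<delta> ^ CARD('n) * real N ^ CARD('n))"
      using c(2) Z d by (simp add: emeasure_ball d_def ennreal_of_nat_eq_real_of_nat mult_ac flip: ennreal_mult)
    ultimately show ?thesis by simp
  qed
  show ?thesis
  proof (rule that[of A "c * A powr (- k / 2)" "unit_ball_vol d * \<delta> ^ CARD('n)" 1])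
    show "0 < unit_ball_vol d * \<delta> ^ CARD('n)" using c d by simp
    show "ennreal (unit_ball_vol d * \<delta> ^ CARD('n) * real N ^ CARD('n)) \<le>
      emeasure lborel {\<xi>. 0 < norm \<xi> \<and> norm \<xi> \<le> A * real N \<and>
        c * A powr (- k / 2) * real N powr (- (real (card I) - 1) / 2) \<le> \<bar>osc \<xi>\<bar>}" if "1 \<le> N" for N
      using large[OF that] by (simp add: k_def)
  qed (use A c in auto)
qed

section \<open>Lorentz and Besov functionals\<close>

lemma nn_integral_inverse_at_0:
  assumes c: "0 < c" and T: "0 < T"
  shows "(\<integral>\<^sup>+ t. indicator {0<..<T} t * ennreal (c / t) \<partial>lborel) = \<infinity>"
    (is "?I = \<infinity>")
proof -
  have le: "ennreal (c * real n) \<le> ?I" for n :: nat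
  proof -
    \<comment> \<open>The integral of \<open>c / t\<close> from this point to \<open>T / 2\<close>
      is exactly \<open>c * n\<close>.\<close>
    define a where "a = T / 2 * exp (- real n)"
    have a: "0 < a" "a \<le> T / 2" using T by (auto simp: a_def)
    have "(\<integral>\<^sup>+ t. ennreal (c / t) * indicator {a..T / 2} t \<partial>lborel) = ennreal (c * ln (T / 2) - c * ln a)"
      using a c by (intro nn_integral_FTC_Icc) (auto intro!: derivative_eq_intros)
    also have "c * ln (T / 2) - c * ln a = c * real n"
      using T by (simp add: a_def ln_mult ln_div algebra_simps)
    finally show ?thesis
      using a T by (auto intro!: nn_integral_mono simp: indicator_def elim!: ord_eq_le_trans[OF sym])
  qed
  show ?thesis
  proof (rule ccontr)
    assume "?I \<noteq> \<infinity>"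
    then obtain r where r: "?I = ennreal r" "0 \<le> r" by (cases ?I) auto
    obtain n :: nat where "r / c < real n" using reals_Archimedean2 by blast
    then have "r < c * real n" using c by (simp add: field_simps)
    with le[of n] r show False by (simp add: ennreal_le_iff)
  qed
qed

lemma epowr_mono: "x \<le> y \<Longrightarrow> 0 \<le> a \<Longrightarrow> epowr x a \<le> epowr y a"
  by (auto simp: epowr_def top_unique less_top[symmetric] intro!: ennreal_leI powr_mono2 enn2real_mono)

text \<open>For small \<open>t\<close>, take \<open>N\<close> of the order of
  \<open>t powr (- 1 / a)\<close>: the level set at \<open>t\<close> then has volume at least a
  constant times \<open>t powr (- DIM('a) / a)\<close>. Its power \<open>q / p\<close> is of order
  \<open>t powr - q\<close>, which against \<open>t powr (q - 1)\<close> leaves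
  \<open>C / t\<close>.\<close>

lemma lorentz_q_eq_infinity:
  fixes g :: "'a::euclidean_space \<Rightarrow> complex" and a c v q :: real and N0 :: nat
  assumes meas: "g \<in> borel_measurable borel" and pos: "0 < a" "0 < c" "0 < v" "0 < q"
    and large: "\<And>N. N0 \<le> N \<Longrightarrow> ennreal (v * real N ^ DIM('a))
      \<le> emeasure lborel {\<xi>. c * real N powr - a \<le> norm (g \<xi>)}"
  shows "lorentz_q (real DIM('a) / a) q g = \<infinity>"
proof -
  let ?d = "DIM('a)" and ?p = "real DIM('a) / a"
  \<comment> \<open>\<open>t < T\<close> makes \<open>X\<close> below exceed \<open>N0 + 2\<close>,
    so its integer part is at least \<open>N0\<close> and at least \<open>X / 2\<close>. The factor
    2 leaves room for the strict inequality that defines the level set.\<close>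
  define T where "T = c / (2 * (real N0 + 2) powr a)"
  define C where "C = v powr (q / ?p) * (1 / 2) powr (q * a) * (c / 2) powr q"
  have d: "0 < real ?d" by simp
  have T: "0 < T" and C: "0 < C" using pos by (auto simp: T_def C_def add_pos_nonneg)
  have "ennreal (C / t) \<le> ennreal (t powr (q - 1)) * epowr (emeasure lborel {\<xi>. t < norm (g \<xi>)}) (q / ?p)"
    if t: "0 < t" "t < T" for t
  proof -
    define X where "X = (c / (2 * t)) powr (1 / a)"
    have "(real N0 + 2) powr a < c / (2 * t)"
      using t pos by (simp add: T_def field_simps add_pos_nonneg)
    then have "((real N0 + 2) powr a) powr (1 / a) < X"
      unfolding X_def using pos by (intro powr_less_mono2) auto
    then have X: "real N0 + 2 < X" using pos by (simp add: powr_powr)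
    have Xa: "X powr a = c / (2 * t)" using pos t by (simp add: X_def powr_powr)
    define N where "N = nat \<lfloor>X\<rfloor>"
    have N: "real N \<le> X" "X - 1 < real N" using X by (auto simp: N_def)
    then have N0: "N0 \<le> N" and N2: "X / 2 \<le> real N" and Npos: "0 < real N" using X by linarith+
    have "t < 2 * t" using t by simp
    also have "2 * t = c / X powr a" using Xa t pos by simp
    also have "\<dots> = c * X powr - a" by (simp add: powr_minus divide_inverse)
    also have "\<dots> \<le> c * real N powr - a"
      using N Npos pos by (intro mult_left_mono powr_mono2') auto
    finally have tN: "t < c * real N powr - a" .
    have "ennreal (v * (X / 2) powr real ?d) \<le> ennreal (v * real N ^ ?d)"
    proof (intro ennreal_leI mult_left_mono)
      have "(X / 2) powr real ?d = (X / 2) ^ ?d" using X by (intro powr_realpow) auto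
      also have "\<dots> \<le> real N ^ ?d" using N2 X by (intro power_mono) auto
      finally show "(X / 2) powr real ?d \<le> real N ^ ?d" .
    qed (use pos in auto)
    also have "\<dots> \<le> emeasure lborel {\<xi>. c * real N powr - a \<le> norm (g \<xi>)}" using N0 by (rule large)
    also have "\<dots> \<le> emeasure lborel {\<xi>. t < norm (g \<xi>)}"
      using meas tN by (intro emeasure_mono) (auto intro: less_le_trans)
    finally have "epowr (ennreal (v * (X / 2) powr real ?d)) (q / ?p)
        \<le> epowr (emeasure lborel {\<xi>. t < norm (g \<xi>)}) (q / ?p)"
      using pos by (intro epowr_mono) auto
    moreover have "epowr (ennreal (v * (X / 2) powr real ?d)) (q / ?p) = ennreal (C * t powr - q)"
    proof -
      have "(v * (X / 2) powr real ?d) powr (q / ?p) = v powr (q / ?p) * (X / 2) powr (q * a)"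
        using pos X d by (simp add: powr_mult powr_powr)
      also have "(X / 2) powr (q * a) = (1 / 2) powr (q * a) * (X powr a) powr q"
        using X by (simp add: powr_divide powr_powr mult.commute)
      also have "(X powr a) powr q = (c / 2) powr q * t powr - q"
        using pos t by (simp add: Xa powr_divide powr_mult powr_minus field_simps)
      finally show ?thesis using pos by (simp add: epowr_def C_def mult.assoc)
    qed
    ultimately have "ennreal (t powr (q - 1)) * ennreal (C * t powr - q)
        \<le> ennreal (t powr (q - 1)) * epowr (emeasure lborel {\<xi>. t < norm (g \<xi>)}) (q / ?p)"
      by (intro mult_left_mono) auto
    moreover have "t powr (q - 1) * (C * t powr - q) = C / t"
      using t by (simp add: powr_diff powr_minus field_simps)
    ultimately show ?thesis by (metis ennreal_mult' powr_ge_zero)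
  qed
  then have "(\<integral>\<^sup>+ t. indicator {0<..<T} t * ennreal (C / t) \<partial>lborel) \<le> lorentz_q ?p q g"
    unfolding lorentz_q_def by (intro nn_integral_mono) (auto simp: indicator_def)
  then show ?thesis using nn_integral_inverse_at_0[OF C T] by (simp add: top_unique)
qed

lemma summable_gaussian_polynomial:
  "summable (\<lambda>j. exp (- (real j)\<^sup>2 / 4) * (real j + 1) ^ k)"
proof (rule summable_comparison_test_bigo)
  show "summable (\<lambda>j. norm (1 / real j ^ 2))"
    using inverse_power_summable[of 2] by (simp add: inverse_eq_divide)
  have "(\<lambda>j. exp (- (real j)\<^sup>2 / 4) * (real j + 1) powr real k) \<in> O(\<lambda>j. 1 / real j ^ 2)"
    by real_asymp
  then show "(\<lambda>j. exp (- (real j)\<^sup>2 / 4) * (real j + 1) ^ k) \<in> O(\<lambda>j. 1 / real j ^ 2)"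
    by (simp add: powr_realpow add_nonneg_pos)
qed

text \<open>Everything scales with \<open>sqrt t\<close>: growth bounds the Gaussian integral by
  \<open>Q * t powr (k / 2)\<close>, and the powers of \<open>t\<close> from the kernel and from the
  Besov weight cancel this exactly. The bound holds at every point \<open>x\<close>.\<close>

lemma besov_finite_of_ball_growth:
  fixes M :: "'a::euclidean_space measure"
  assumes sets: "sets M = sets borel" and K: "0 \<le> K"
    and growth: "\<And>x r. 0 < r \<Longrightarrow> emeasure M (ball x r) \<le> ennreal (K * r ^ k)"
  shows "besov_finite (real k) M"
proof -
  define Q where "Q = K * (\<Sum>j. exp (- (real j)\<^sup>2 / 4) * (real j + 1) ^ k)"
  have Q: "0 \<le> Q" unfolding Q_def using K by (intro mult_nonneg_nonneg suminf_nonneg summable_gaussian_polynomial) auto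
  note [measurable_cong] = sets
  have gauss: "(\<integral>\<^sup>+ y. ennreal (exp (- (norm (x - y))\<^sup>2 / (4 * t))) \<partial>M) \<le> ennreal (Q * t powr (real k / 2))"
    if t: "0 < t" for x t
  proof -
    \<comment> \<open>Whole balls serve in place of annuli: only the term of the shell containing
      \<open>y\<close> is used, and the Gaussian weights keep the overcounted series
      summable.\<close>
    let ?B = "\<lambda>j. ball x ((real j + 1) * sqrt t)"
    have "ennreal (exp (- (norm (x - y))\<^sup>2 / (4 * t)))
        \<le> (\<Sum>j. ennreal (exp (- (real j)\<^sup>2 / 4)) * indicator (?B j) y)" for y
    proof -
      define j where "j = nat \<lfloor>norm (x - y) / sqrt t\<rfloor>"
      have j: "real j \<le> norm (x - y) / sqrt t" "norm (x - y) / sqrt t < real j + 1"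
        using t by (auto simp: j_def)
      have "(real j)\<^sup>2 \<le> (norm (x - y) / sqrt t)\<^sup>2" using j(1) by (intro power_mono) auto
      then have "(real j)\<^sup>2 / 4 \<le> (norm (x - y))\<^sup>2 / (4 * t)" using t by (simp add: power_divide)
      then have "ennreal (exp (- (norm (x - y))\<^sup>2 / (4 * t))) \<le> ennreal (exp (- (real j)\<^sup>2 / 4))"
        by (intro ennreal_leI) simp
      also have "\<dots> = ennreal (exp (- (real j)\<^sup>2 / 4)) * indicator (?B j) y"
        using j(2) t by (simp add: dist_norm pos_divide_less_eq)
      also have "\<dots> \<le> (\<Sum>j. ennreal (exp (- (real j)\<^sup>2 / 4)) * indicator (?B j) y)"
      proof -
        let ?f = "\<lambda>j. ennreal (exp (- (real j)\<^sup>2 / 4)) * indicator (?B j) y"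
        have "sum ?f {j} \<le> suminf ?f" by (rule sum_le_suminf) auto
        then show ?thesis
          by (simp only: sum.insert finite.emptyI empty_iff not_False_eq_True sum.empty add_0_right)
      qed
      finally show ?thesis .
    qed
    then have "(\<integral>\<^sup>+ y. ennreal (exp (- (norm (x - y))\<^sup>2 / (4 * t))) \<partial>M)
        \<le> (\<integral>\<^sup>+ y. (\<Sum>j. ennreal (exp (- (real j)\<^sup>2 / 4)) * indicator (?B j) y) \<partial>M)"
      by (intro nn_integral_mono)
    also have "\<dots> = (\<Sum>j. \<integral>\<^sup>+ y. ennreal (exp (- (real j)\<^sup>2 / 4)) * indicator (?B j) y \<partial>M)"
      by (intro nn_integral_suminf borel_measurable_times_ennreal borel_measurable_indicator) (auto simp: sets)
    also have "\<dots> = (\<Sum>j. ennreal (exp (- (real j)\<^sup>2 / 4)) * emeasure M (?B j))"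
      by (intro suminf_cong nn_integral_cmult_indicator) (simp add: sets)
    also have "\<dots> \<le> (\<Sum>j. ennreal (K * t powr (real k / 2) * (exp (- (real j)\<^sup>2 / 4) * (real j + 1) ^ k)))"
    proof (intro suminf_le allI)
      fix j
      have "ennreal (exp (- (real j)\<^sup>2 / 4)) * emeasure M (?B j)
          \<le> ennreal (exp (- (real j)\<^sup>2 / 4)) * ennreal (K * ((real j + 1) * sqrt t) ^ k)"
        using t by (intro mult_left_mono growth) auto
      also have "\<dots> = ennreal (K * t powr (real k / 2) * (exp (- (real j)\<^sup>2 / 4) * (real j + 1) ^ k))"
      proof -
        have "sqrt t ^ k = t powr (real k / 2)"
          using t by (simp add: powr_half_sqrt[symmetric] powr_powr flip: powr_realpow)
        then show ?thesis using K by (simp add: ennreal_mult'[symmetric] power_mult_distrib mult_ac)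
      qed
      finally show "ennreal (exp (- (real j)\<^sup>2 / 4)) * emeasure M (?B j)
          \<le> ennreal (K * t powr (real k / 2) * (exp (- (real j)\<^sup>2 / 4) * (real j + 1) ^ k))" .
    qed auto
    also have "\<dots> = ennreal (K * t powr (real k / 2) * (\<Sum>j. exp (- (real j)\<^sup>2 / 4) * (real j + 1) ^ k))"
      using K by (intro suminf_ennreal_eq sums_mult summable_sums summable_gaussian_polynomial) auto
    also have "\<dots> = ennreal (Q * t powr (real k / 2))" by (simp add: Q_def mult_ac)
    finally show ?thesis .
  qed
  have bound: "t powr ((real DIM('a) - real k) / 2) * \<bar>\<integral> y. heat_kernel t (x - y) \<partial>M\<bar>
      \<le> (4 * pi) powr (- real DIM('a) / 2) * Q" if t: "0 < t" for t and x :: 'a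
  proof -
    let ?d = "real DIM('a)"
    have "(\<integral> y. exp (- (norm (x - y))\<^sup>2 / (4 * t)) \<partial>M)
        = enn2real (\<integral>\<^sup>+ y. ennreal (exp (- (norm (x - y))\<^sup>2 / (4 * t))) \<partial>M)"
      by (intro integral_eq_nn_integral) auto
    also have "\<dots> \<le> Q * t powr (real k / 2)"
      using gauss[OF t, of x] Q by (intro enn2real_leI) auto
    finally have le: "(\<integral> y. exp (- (norm (x - y))\<^sup>2 / (4 * t)) \<partial>M) \<le> Q * t powr (real k / 2)" .
    have "\<bar>\<integral> y. heat_kernel t (x - y) \<partial>M\<bar>
        = (4 * pi * t) powr (- ?d / 2) * (\<integral> y. exp (- (norm (x - y))\<^sup>2 / (4 * t)) \<partial>M)"
      unfolding heat_kernel_def by (simp add: abs_mult)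
    also have "\<dots> \<le> (4 * pi * t) powr (- ?d / 2) * (Q * t powr (real k / 2))"
      using le by (intro mult_left_mono) auto
    finally have "t powr ((?d - real k) / 2) * \<bar>\<integral> y. heat_kernel t (x - y) \<partial>M\<bar>
        \<le> t powr ((?d - real k) / 2) * ((4 * pi * t) powr (- ?d / 2) * (Q * t powr (real k / 2)))"
      by (intro mult_left_mono) auto
    also have "\<dots> = (4 * pi) powr (- ?d / 2) * Q * (t powr ((?d - real k) / 2) * t powr (- ?d / 2) * t powr (real k / 2))"
      using t by (simp add: powr_mult mult_ac)
    also have "t powr ((?d - real k) / 2) * t powr (- ?d / 2) * t powr (real k / 2) = 1"
      using t by (simp add: field_simps flip: powr_add)
    finally show ?thesis by simp
  qed
  then show ?thesis unfolding besov_finite_def by (intro exI allI impI AE_I2) blast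
qed

section \<open>Surface measure\<close>

lemma coord_rank_less_iff:
  fixes i j :: "'n::{finite,wellorder}"
  shows "coord_rank i < coord_rank j \<longleftrightarrow> i < j"
proof -
  have less: "coord_rank i < coord_rank j" if "i < j" for i j :: 'n
    unfolding coord_rank_def using that by (intro psubset_card_mono) auto
  then show ?thesis by (metis not_less_iff_gr_or_eq)
qed

lemma bij_betw_coord_rank: "bij_betw coord_rank (UNIV :: 'n::{finite,wellorder} set) {..<CARD('n)}"
proof -
  have inj: "inj (coord_rank :: 'n \<Rightarrow> nat)"
    by (rule injI) (metis coord_rank_less_iff less_irrefl linorder_neqE)
  have "range (coord_rank :: 'n \<Rightarrow> nat) \<subseteq> {..<CARD('n)}"
    unfolding coord_rank_def by (auto intro!: psubset_card_mono)
  then have "range (coord_rank :: 'n \<Rightarrow> nat) = {..<CARD('n)}"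
    using inj by (intro card_subset_eq) (auto simp: card_image)
  with inj show ?thesis by (simp add: bij_betw_def)
qed

lemma card_coord_rank_less:
  assumes "m \<le> CARD('n::{finite,wellorder})"
  shows "card {i :: 'n. coord_rank i < m} = m"
proof -
  have "card (coord_rank -` {..<m} :: 'n set) = card {..<m}"
    using bij_betw_coord_rank[where 'n = 'n] assms
    by (intro card_vimage_inj) (auto simp: bij_betw_def)
  then show ?thesis by (simp add: vimage_def)
qed

lemma sphere_k_eq: "sphere_k k = coord_sphere {i. coord_rank i < k + 1}"
  by (auto simp: sphere_k_def coord_sphere_def not_less)

lemma closed_coord_sphere: "closed (coord_sphere I)"
proof -
  have "coord_sphere I = (\<Inter>i\<in>- I. {x. x $ i = 0}) \<inter> {x. norm x = 1}"
    by (auto simp: coord_sphere_def)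
  then show ?thesis
    by (auto intro!: closed_Collect_eq closed_INT continuous_intros)
qed

text \<open>The image of a cover covers the image, with no larger diameters. For an involution, a
  second application gives the reverse inequality.\<close>

lemma hausdorff_measure_isometry_le:
  fixes f :: "'a::real_normed_vector \<Rightarrow> 'a"
  assumes iso: "\<And>x y. dist (f x) (f y) = dist x y" and s: "0 \<le> s"
  shows "hausdorff_measure s (f ` A) \<le> hausdorff_measure s A"
  unfolding hausdorff_measure_def
proof (rule SUP_mono')
  fix \<delta> :: real
  show "hausdorff_pre s \<delta> (f ` A) \<le> hausdorff_pre s \<delta> A"
    unfolding hausdorff_pre_def[of s \<delta> A]
  proof (rule INF_greatest)
    fix C :: "nat \<Rightarrow> 'a set"
    assume "C \<in> {C. A \<subseteq> (\<Union>i. C i) \<and> (\<forall>i. bounded (C i) \<and> diameter (C i) \<le> \<delta>)}"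
    then have C: "A \<subseteq> (\<Union>i. C i)" "\<And>i. bounded (C i)" "\<And>i. diameter (C i) \<le> \<delta>" by auto
    have diam: "diameter (f ` C i) \<le> diameter (C i)" for i
      using C(2)[of i] diameter_bounded_bound[OF C(2)[of i]]
      by (intro diameter_le) (auto simp: diameter_ge_0 iso simp flip: dist_norm)
    have bdd: "bounded (f ` C i)" for i
    proof -
      obtain x e where "\<forall>y\<in>C i. dist x y \<le> e" using C(2)[of i] by (auto simp: bounded_def)
      then show ?thesis unfolding bounded_def by (intro exI[of _ "f x"] exI[of _ e]) (auto simp: iso)
    qed
    have "hausdorff_pre s \<delta> (f ` A) \<le> (\<Sum>i. ennreal (omega_s s * (diameter (f ` C i) / 2) powr s))"
    proof (rule hausdorff_pre_le)
      show "f ` A \<subseteq> (\<Union>i. f ` C i)" using C(1) by blast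
    qed (use C bdd in \<open>auto intro: order_trans[OF diam]\<close>)
    also have "\<dots> \<le> (\<Sum>i. ennreal (omega_s s * (diameter (C i) / 2) powr s))"
      using diam bdd omega_s_pos[OF s] s
      by (intro suminf_le allI ennreal_leI mult_left_mono powr_mono2) (auto simp: diameter_ge_0)
    finally show "hausdorff_pre s \<delta> (f ` A) \<le> (\<Sum>i. ennreal (omega_s s * (diameter (C i) / 2) powr s))" .
  qed
qed

lemma sets_mu_k [simp]: "sets (mu_k k :: (real^'n::{finite,wellorder}) measure) = sets borel"
  using sets.sigma_sets_eq[of "borel :: (real, 'n) vec measure"] by (simp add: mu_k_def)

text \<open>Without countable additivity \<open>measure_of\<close> would return 0. It comes from the
  Borel theorem because the sphere is closed, so intersecting with it keeps disjoint Borel sets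
  disjoint and Borel.\<close>

lemma emeasure_mu_k:
  fixes A :: "(real^'n::{finite,wellorder}) set"
  assumes A: "A \<in> sets borel"
  shows "emeasure (mu_k k) A = hausdorff_measure (real k) (A \<inter> sphere_k k)"
proof (rule emeasure_measure_of[OF mu_k_def])
  have S: "sphere_k k \<in> sets borel" unfolding sphere_k_eq by (intro borel_closed closed_coord_sphere)
  have ca: "countably_additive (sets borel) (hausdorff_measure (real k) :: (real, 'n) vec set \<Rightarrow> ennreal)"
    using measure_space_hausdorff_borel[where 'a = "(real, 'n) vec", of "real k"] by (simp add: measure_space_def)
  show "countably_additive (sets (mu_k k)) (\<lambda>A. hausdorff_measure (real k) (A \<inter> sphere_k k :: (real, 'n) vec set))"
  proof (rule countably_additiveI)
    fix A :: "nat \<Rightarrow> (real, 'n) vec set"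
    assume A: "range A \<subseteq> sets (mu_k k)" "disjoint_family A"
    have "range (\<lambda>i. A i \<inter> sphere_k k) \<subseteq> sets borel" using A S by auto
    moreover have "disjoint_family (\<lambda>i. A i \<inter> sphere_k k)" using A by (auto simp: disjoint_family_on_def)
    moreover from calculation(1) have "(\<Union>i. A i \<inter> sphere_k k) \<in> sets borel" by (intro sets.countable_UN) auto
    ultimately have "(\<Sum>i. hausdorff_measure (real k) (A i \<inter> sphere_k k)) = hausdorff_measure (real k) (\<Union>i. A i \<inter> sphere_k k)"
      using ca unfolding countably_additive_def by blast
    then show "(\<Sum>i. hausdorff_measure (real k) (A i \<inter> sphere_k k)) = hausdorff_measure (real k) (\<Union> (range A) \<inter> sphere_k k)"
      by simp
  qed
qed (use A in \<open>auto simp: positive_def\<close>)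

lemma mu_k_ball_growth:
  fixes k :: nat
  assumes k: "1 \<le> k" "k + 1 \<le> CARD('n::{finite,wellorder})"
  obtains K where "0 \<le> K"
    "\<And>x r. 0 < r \<Longrightarrow> emeasure (mu_k k :: (real^'n::{finite,wellorder}) measure) (ball x r) \<le> ennreal (K * r ^ k)"
proof -
  obtain K where "0 \<le> K" "\<And>(x :: (real, 'n) vec) r. 0 < r \<Longrightarrow>
      hausdorff_measure (real k) (coord_sphere {i. coord_rank i < k + 1} \<inter> ball x r) \<le> ennreal (K * r ^ k)"
    by (rule hausdorff_coord_sphere_ball[OF card_coord_rank_less[OF k(2)] k(1)]) blast
  then show ?thesis
    by (intro that[of K]) (auto simp: emeasure_mu_k sphere_k_eq Int_commute)
qed

lemma spherical_measure_mu_k: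
  fixes k :: nat
  assumes k: "1 \<le> k" "k + 1 \<le> CARD('n::{finite,wellorder})"
  shows "spherical_measure (mu_k k :: (real^'n::{finite,wellorder}) measure) {i. coord_rank i < k + 1}"
proof -
  let ?M = "mu_k k :: (real, 'n) vec measure" and ?I = "{i :: 'n. coord_rank i < k + 1}"
  have space: "space ?M = UNIV" using sets_eq_imp_space_eq[OF sets_mu_k[of k]] by simp
  have em_space: "emeasure ?M (space ?M) = hausdorff_measure (real k) (coord_sphere ?I)"
    by (simp add: space emeasure_mu_k sphere_k_eq)
  obtain K where K: "\<And>(x :: (real, 'n) vec) r. 0 < r \<Longrightarrow> emeasure ?M (ball x r) \<le> ennreal (K * r ^ k)"
    by (rule mu_k_ball_growth[OF k]) blast
  \<comment> \<open>The ball contains the sphere, so the growth bound at a single radius gives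
    finite mass.\<close>
  have "emeasure ?M (space ?M) = emeasure ?M (ball 0 2)"
    by (simp add: space emeasure_mu_k sphere_k_eq) (rule arg_cong[where f = "hausdorff_measure _"],
      auto simp: coord_sphere_def)
  also have "\<dots> < \<infinity>" using K[of 2 0] by (auto intro: le_less_trans)
  finally have fin: "emeasure ?M (space ?M) \<noteq> \<infinity>" by simp
  show ?thesis
  proof (intro spherical_measure.intro spherical_measure_axioms.intro finite_measureI fin)
    show "emeasure ?M (space ?M) \<noteq> 0"
      using hausdorff_coord_sphere_pos[OF card_coord_rank_less[OF k(2)] k(1)] by (simp add: em_space)
    have "AE x in ?M. x \<notin> - coord_sphere ?I"
    proof (rule AE_not_in, rule null_setsI)
      show "emeasure ?M (- coord_sphere ?I) = 0" "- coord_sphere ?I \<in> sets ?M"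
        using borel_closed[OF closed_coord_sphere, of ?I] by (auto simp: emeasure_mu_k sphere_k_eq)
    qed
    then show "AE x in ?M. x \<in> coord_sphere ?I" by simp
    fix v :: "(real, 'n) vec" assume v: "\<forall>i. i \<notin> ?I \<longrightarrow> v $ i = 0"
    have meas: "reflection v \<in> measurable ?M ?M"
      by (simp cong: measurable_cong_sets[OF sets_mu_k sets_mu_k])
    have sphere: "reflection v x \<in> coord_sphere ?I" if "x \<in> coord_sphere ?I" for x
    proof -
      have "reflection v x $ i = 0" if "i \<notin> ?I" for i
        using that v \<open>x \<in> coord_sphere ?I\<close> by (simp add: coord_sphere_def reflection_def)
      then show ?thesis using that by (simp add: coord_sphere_def)
    qed
    show "distr ?M ?M (reflection v) = ?M"
    proof (rule measure_eqI)
      fix A assume "A \<in> sets (distr ?M ?M (reflection v))"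
      then have A: "A \<in> sets borel" by simp
      have preA: "reflection v -` A \<in> sets borel"
        using measurable_sets[OF borel_measurable_reflection A] by simp
      have image: "reflection v -` A \<inter> coord_sphere ?I = reflection v ` (A \<inter> coord_sphere ?I)"
      proof (intro equalityI subsetI)
        fix x assume x: "x \<in> reflection v -` A \<inter> coord_sphere ?I"
        then have "reflection v x \<in> A \<inter> coord_sphere ?I" using sphere[of x] by blast
        then show "x \<in> reflection v ` (A \<inter> coord_sphere ?I)"
          by (rule image_eqI[rotated]) (rule reflection_involutive[symmetric])
      next
        fix x assume "x \<in> reflection v ` (A \<inter> coord_sphere ?I)"
        then obtain y where "x = reflection v y" "y \<in> A" "y \<in> coord_sphere ?I" by blast
        then show "x \<in> reflection v -` A \<inter> coord_sphere ?I" using sphere[of y] by simp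
      qed
      \<comment> \<open>The reflection is its own inverse, so the isometry inequality also applies
        to the preimage and yields equality.\<close>
      have image': "reflection v ` (reflection v -` A \<inter> coord_sphere ?I) = A \<inter> coord_sphere ?I"
        unfolding image image_image reflection_involutive by (rule image_ident)
      have "emeasure (distr ?M ?M (reflection v)) A = hausdorff_measure (real k) (reflection v -` A \<inter> coord_sphere ?I)"
        using A preA by (simp add: emeasure_distr[OF meas] space emeasure_mu_k sphere_k_eq)
      also have "\<dots> = hausdorff_measure (real k) (A \<inter> coord_sphere ?I)"
      proof (rule antisym)
        show "hausdorff_measure (real k) (reflection v -` A \<inter> coord_sphere ?I) \<le> hausdorff_measure (real k) (A \<inter> coord_sphere ?I)"
          unfolding image by (rule hausdorff_measure_isometry_le) auto
        show "hausdorff_measure (real k) (A \<inter> coord_sphere ?I) \<le> hausdorff_measure (real k) (reflection v -` A \<inter> coord_sphere ?I)"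
          using hausdorff_measure_isometry_le[of "reflection v" "real k" "reflection v -` A \<inter> coord_sphere ?I"]
          unfolding image' by simp
      qed
      finally show "emeasure (distr ?M ?M (reflection v)) A = emeasure ?M A"
        using A by (simp add: emeasure_mu_k sphere_k_eq)
    qed simp
  qed simp
qed

section \<open>The transform of the Riesz potential and the final assembly\<close>

context spherical_measure
begin

lemma abs_osc_le_fourier_measure: "\<bar>osc \<xi>\<bar> \<le> norm (fourier_measure M \<xi>)"
proof -
  have "(\<lambda>x. cis (- 2 * pi * (x \<bullet> \<xi>))) \<in> borel_measurable M"
    by (simp add: cis_conv_exp borel_measurable_continuous_onI continuous_intros
        cong: measurable_cong_sets[OF sets_M refl])
  then have "integrable M (\<lambda>x. cis (- 2 * pi * (x \<bullet> \<xi>)))"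
    by (intro integrable_const_bound[of _ 1]) auto
  then have "Re (fourier_measure M \<xi>) = osc \<xi>"
    unfolding fourier_measure_def osc_def by (simp add: integral_Re[symmetric])
  then show ?thesis by (metis abs_Re_le_cmod)
qed

text \<open>A non-measurable set has \<open>emeasure\<close> 0, so lower bounds on level sets
  require this. The integrand is jointly continuous, hence jointly measurable.\<close>

lemma borel_measurable_fourier_riesz: "fourier_riesz \<alpha> M \<in> borel_measurable borel"
proof -
  have "(\<lambda>p :: (real^'n) \<times> (real^'n). cis (- 2 * pi * (snd p \<bullet> fst p))) \<in> borel_measurable borel"
    unfolding cis_conv_exp by (intro borel_measurable_continuous_onI continuous_intros)
  then have "(\<lambda>p. cis (- 2 * pi * (snd p \<bullet> fst p))) \<in> borel_measurable (borel \<Otimes>\<^sub>M M)"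
    unfolding measurable_cong_sets[OF sets_pair_measure_cong[OF refl sets_M] refl] borel_prod .
  then have "fourier_measure M \<in> borel_measurable borel"
    unfolding fourier_measure_def[abs_def]
    by (intro borel_measurable_lebesgue_integral) (simp add: split_beta')
  then show ?thesis
    unfolding fourier_riesz_def[abs_def]
    by (intro borel_measurable_times borel_measurable_of_real powr_real_measurable borel_measurable_const
        borel_measurable_norm measurable_ident) auto
qed

lemma lorentz_q_fourier_riesz:
  assumes I: "I \<noteq> {}" and a: "0 \<le> \<alpha>" "0 < \<alpha> + (real (card I) - 1) / 2" and q: "0 < q"
  shows "lorentz_q (real CARD('n) / (\<alpha> + (real (card I) - 1) / 2)) q (fourier_riesz \<alpha> M) = \<infinity>"
proof -
  define \<beta> where "\<beta> = (real (card I) - 1) / 2"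
  have \<beta>: "- (real (card I) - 1) / 2 = - \<beta>" by (simp only: \<beta>_def minus_divide_left)
  obtain A c v N0 where osc: "0 < A" "0 < c" "0 < v" "0 < (N0 :: nat)"
    "\<And>N. N0 \<le> N \<Longrightarrow> ennreal (v * real N ^ CARD('n)) \<le>
      emeasure lborel {\<xi>. 0 < norm \<xi> \<and> norm \<xi> \<le> A * real N \<and> c * real N powr - \<beta> \<le> \<bar>osc \<xi>\<bar>}"
    by (rule osc_large_set[OF I, unfolded \<beta>]) (rule that; blast)
  \<comment> \<open>The Riesz factor at the largest admissible radius, \<open>A * N\<close>, with
    the power of \<open>N\<close> split off.\<close>
  define c' where "c' = (2 * pi * A) powr - \<alpha> * c"
  have "lorentz_q (real DIM(real^'n) / (\<alpha> + \<beta>)) q (fourier_riesz \<alpha> M) = \<infinity>"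
  proof (rule lorentz_q_eq_infinity[where ?N0.0 = N0 and c = c' and v = v])
    fix N assume N: "N0 \<le> N"
    have "ennreal (v * real N ^ CARD('n)) \<le>
      emeasure lborel {\<xi>. 0 < norm \<xi> \<and> norm \<xi> \<le> A * real N \<and> c * real N powr - \<beta> \<le> \<bar>osc \<xi>\<bar>}"
      using N by (rule osc(5))
    also have "\<dots> \<le> emeasure lborel {\<xi>. c' * real N powr - (\<alpha> + \<beta>) \<le> norm (fourier_riesz \<alpha> M \<xi>)}"
    proof (rule emeasure_mono)
      show "{\<xi>. c' * real N powr - (\<alpha> + \<beta>) \<le> norm (fourier_riesz \<alpha> M \<xi>)} \<in> sets lborel"
        using borel_measurable_fourier_riesz[of \<alpha>] by simp
      show "{\<xi>. 0 < norm \<xi> \<and> norm \<xi> \<le> A * real N \<and> c * real N powr - \<beta> \<le> \<bar>osc \<xi>\<bar>}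
        \<subseteq> {\<xi>. c' * real N powr - (\<alpha> + \<beta>) \<le> norm (fourier_riesz \<alpha> M \<xi>)}"
      proof clarify
        fix \<xi> assume \<xi>: "0 < norm \<xi>" "norm \<xi> \<le> A * real N" "c * real N powr - \<beta> \<le> \<bar>osc \<xi>\<bar>"
        have "c' * real N powr - (\<alpha> + \<beta>) = (2 * pi * (A * real N)) powr - \<alpha> * (c * real N powr - \<beta>)"
        proof -
          have "real N powr - (\<alpha> + \<beta>) = real N powr - \<alpha> * real N powr - \<beta>" by (simp flip: powr_add)
          then show ?thesis using osc(1) by (simp only: c'_def powr_mult) simp
        qed
        \<comment> \<open>Negative powers decrease, so \<open>norm \<xi> \<le> A * N\<close> bounds
          the Riesz factor from below. The origin was excluded because
          \<open>0 powr - \<alpha> = 0\<close>.\<close>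
        also have "\<dots> \<le> (2 * pi * norm \<xi>) powr - \<alpha> * norm (fourier_measure M \<xi>)"
          using \<xi> a osc(2) abs_osc_le_fourier_measure[of \<xi>]
          by (intro mult_mono powr_mono2') (auto intro: order_trans)
        finally show "c' * real N powr - (\<alpha> + \<beta>) \<le> norm (fourier_riesz \<alpha> M \<xi>)"
          by (simp add: fourier_riesz_def norm_mult)
      qed
    qed
    finally show "ennreal (v * real N ^ DIM(real^'n)) \<le>
        emeasure lborel {\<xi>. c' * real N powr - (\<alpha> + \<beta>) \<le> norm (fourier_riesz \<alpha> M \<xi>)}"
      by simp
  next
    show "0 < \<alpha> + \<beta>" using a by (simp add: \<beta>_def)
    show "0 < c'" using osc(1,2) by (simp add: c'_def)
  qed (fact borel_measurable_fourier_riesz osc(3) q)+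
  then show ?thesis by (simp add: \<beta>_def)
qed

end

theorem theorem1p7:
  fixes k :: nat and \<alpha> :: real
  assumes "1 \<le> k" and "k + 1 \<le> CARD('n::{finite,wellorder})"
    and "0 < \<alpha>" and "\<alpha> < real CARD('n::{finite,wellorder})"
    and "(real CARD('n::{finite,wellorder}) - real k) / 2 < \<alpha>" and "\<alpha> < real CARD('n::{finite,wellorder}) - real k / 2"
  shows "finite_measure (mu_k k :: (real^'n::{finite,wellorder}) measure) \<and> sets (mu_k k :: (real^'n::{finite,wellorder}) measure) = sets borel
    \<and> besov_finite (real k) (mu_k k :: (real^'n::{finite,wellorder}) measure)
    \<and> (\<forall>q::real. 0 < q \<longrightarrow>
         lorentz_q (2 * real CARD('n::{finite,wellorder}) / (2 * \<alpha> + real k)) q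
           (fourier_riesz \<alpha> (mu_k k :: (real^'n::{finite,wellorder}) measure)) = \<infinity>)"
proof -
  let ?I = "{i :: 'n. coord_rank i < k + 1}"
  interpret spherical_measure "mu_k k :: (real, 'n) vec measure" ?I
    using assms by (intro spherical_measure_mu_k)
  have card: "card ?I = k + 1" using assms by (intro card_coord_rank_less)
  obtain K where "0 \<le> K"
    "\<And>x r. 0 < r \<Longrightarrow> emeasure (mu_k k :: (real, 'n) vec measure) (ball x r) \<le> ennreal (K * r ^ k)"
    by (rule mu_k_ball_growth[OF assms(1,2)]) blast
  then have besov: "besov_finite (real k) (mu_k k :: (real, 'n) vec measure)"
    by (intro besov_finite_of_ball_growth) auto
  have exponent: "2 * real CARD('n) / (2 * \<alpha> + real k) = real CARD('n) / (\<alpha> + (real (card ?I) - 1) / 2)"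
    unfolding card using assms(3) by (simp add: field_simps add_pos_nonneg)
  have "lorentz_q (2 * real CARD('n) / (2 * \<alpha> + real k)) q (fourier_riesz \<alpha> (mu_k k :: (real, 'n) vec measure)) = \<infinity>"
    if "0 < q" for q
    unfolding exponent
  proof (rule lorentz_q_fourier_riesz)
    show "?I \<noteq> {}" using card by force
    show "0 < \<alpha> + (real (card ?I) - 1) / 2" unfolding card using assms(3) by simp
  qed (use assms(3) that in auto)
  then show ?thesis using besov finite_measure_axioms by auto
qed

end
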